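(* Let $\mathrm{Hyp}_n$ denote the hypermetric cone in $\mathbb{R}^{\binom{n}{2}}$. The symmetry group $Is(\mathrm{Hyp}_n)$ is isomorphic to $\mathrm{Sym}(n)$ for every integer $n\ge 5$, and to $\mathrm{Sym}(3)\times\mathrm{Sym}(4)$ for $n=4$.
   Context: Points of $\mathbb{R}^{\binom{n}{2}}$ are written $x=(x_{ij})_{1\le i<j\le n}$, and $\mathbb{R}^{\binom{n}{2}}$ carries its standard Euclidean structure. The hypermetric cone $\mathrm{Hyp}_n$ is the set of all $x\in\mathbb{R}^{\binom{n}{2}}$ satisfying all hypermetric inequalities $$\sum_{1\le i<j\le n} b_ib_j\,x_{ij}\le 0\qquad\text{for all } b=(b_1,\dots,b_n)\in\mathbb{Z}^n \text{ with } \sum_{i=1}^n b_i=1.$$ The symmetry group $Is(P)$ of $P\subseteq\mathbb{R}^N$ is the group, under composition, of all linear transformations $g$ of $\mathbb{R}^N$ preserving the Euclidean distance and such that $g(P)=P$. $\mathrm{Sym}(m)$ denotes the symmetric group on $m$ letters. *)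

theory Defs
  imports "HOL-Analysis.L2_Norm" "HOL-Algebra.Sym_Groups"
begin

text \<open>
  For a finite index set \<open>I\<close>, the Euclidean space of real vectors with coordinates in \<open>I\<close> is the
  set of functions that vanish outside \<open>I\<close>, so that each vector has exactly one representative.
  The distance is \<^term>\<open>L2_set\<close> of the coordinatewise difference.
\<close>

definition coord_space :: "'i set \<Rightarrow> ('i \<Rightarrow> real) set" where
  "coord_space I = {x. \<forall>i. i \<notin> I \<longrightarrow> x i = 0}"

definition euclid_dist :: "'i set \<Rightarrow> ('i \<Rightarrow> real) \<Rightarrow> ('i \<Rightarrow> real) \<Rightarrow> real" where
  "euclid_dist I x y = L2_set (\<lambda>i. x i - y i) I"

text \<open>
  Linear self-maps of the coordinate space are represented by functions that are
  \<^const>\<open>undefined\<close> outside it, so that equality of representatives is equality of maps.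
\<close>

definition linear_transformations ::
    "'i set \<Rightarrow> (('i \<Rightarrow> real) \<Rightarrow> ('i \<Rightarrow> real)) set" where
  "linear_transformations I =
     {g \<in> coord_space I \<rightarrow>\<^sub>E coord_space I.
        (\<forall>x\<in>coord_space I. \<forall>y\<in>coord_space I.
           g (\<lambda>i. x i + y i) = (\<lambda>i. g x i + g y i)) \<and>
        (\<forall>c. \<forall>x\<in>coord_space I. g (\<lambda>i. c * x i) = (\<lambda>i. c * g x i))}"

definition symmetry_group ::
    "'i set \<Rightarrow> ('i \<Rightarrow> real) set \<Rightarrow> (('i \<Rightarrow> real) \<Rightarrow> ('i \<Rightarrow> real)) monoid" where
  "symmetry_group I P =
     \<lparr>carrier = {g \<in> linear_transformations I.
        (\<forall>x\<in>coord_space I. \<forall>y\<in>coord_space I.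
           euclid_dist I (g x) (g y) = euclid_dist I x y) \<and> g ` P = P},
      mult = (\<lambda>g h. compose (coord_space I) g h),
      one = (\<lambda>x\<in>coord_space I. x)\<rparr>"

definition pairs :: "nat \<Rightarrow> (nat \<times> nat) set" where
  "pairs n = {(i, j). 1 \<le> i \<and> i < j \<and> j \<le> n}"

definition hypermetric_cone :: "nat \<Rightarrow> (nat \<times> nat \<Rightarrow> real) set" where
  "hypermetric_cone n =
     {x \<in> coord_space (pairs n).
        \<forall>b :: nat \<Rightarrow> int. (\<Sum>i=1..n. b i) = 1 \<longrightarrow>
          (\<Sum>(i, j)\<in>pairs n. real_of_int (b i * b j) * x (i, j)) \<le> 0}"

end

theory Submission
  imports Defs
begin

text \<open>
  Write \<open>\<delta>(A)\<close> for the cut vectors, \<open>\<one>\<close> for the all-ones vector and \<open>r\<^sub>i = \<langle>x, \<delta>({i})\<rangle>\<close> for the row sums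
  of \<open>x\<close>. The triangle inequalities give \<open>(n - 1) |x|\<^sup>2 \<le> \<langle>x, \<one>\<rangle>\<^sup>2\<close> on the cone, with equality exactly
  on the rays of the \<open>\<delta>({i})\<close>. Hence a symmetry \<open>g\<close> satisfies \<open>\<langle>g \<one>, \<delta>({i})\<rangle> \<ge> n - 1\<close> for every \<open>i\<close>;
  summing over \<open>i\<close> gives \<open>\<langle>g \<one>, \<one>\<rangle> \<ge> |\<one>|\<^sup>2\<close>, so \<open>g \<one> = \<one>\<close> because \<open>g\<close> is an isometry. By the
  equality case \<open>g\<close> then permutes the \<open>\<delta>({i})\<close>.

  For \<open>n \<ge> 5\<close> a point of the cone with the row sums and the norm of \<open>\<delta>({i, j})\<close> is \<open>\<delta>({i, j})\<close> itself.
  So the permutation of the \<open>\<delta>({i})\<close> determines \<open>g\<close> on all \<open>\<delta>({i, j})\<close>, and these vectors together span.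

  For \<open>n = 4\<close> let \<open>q\<^sub>1, q\<^sub>2, q\<^sub>3\<close> be the sums of \<open>x\<close> over the three perfect matchings. The numbers \<open>r\<^sub>i\<close>
  and \<open>q\<^sub>k\<close> determine \<open>x\<close>, are subject only to \<open>\<Sum> r\<^sub>i = 2 \<Sum> q\<^sub>k\<close>, and the cone is
  \<open>{x. \<forall>k i. q\<^sub>k \<le> r\<^sub>i}\<close>; so the \<open>r\<^sub>i\<close> and the \<open>q\<^sub>k\<close> may be permuted independently.
\<close>

section \<open>Finite semimetrics\<close>

text \<open>The rows and columns of \<open>a\<close> and \<open>b\<close> cover everything outside
  the block over \<open>V - {a, b}\<close>. They overlap on the block over \<open>{a, b}\<close>,
  whose sum is \<open>2 * f a b\<close> because the diagonal vanishes.\<close>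

lemma double_sum_split:
  fixes f :: "'a \<Rightarrow> 'a \<Rightarrow> real"
  assumes fin: "finite V" and ab: "a \<in> V" "b \<in> V" "a \<noteq> b"
    and sym: "\<And>i j. \<lbrakk>i \<in> V; j \<in> V\<rbrakk> \<Longrightarrow> f i j = f j i"
    and refl: "\<And>i. f i i = 0"
  shows "(\<Sum>i\<in>V. \<Sum>j\<in>V. f i j) = 2 * ((\<Sum>j\<in>V. f a j) + (\<Sum>j\<in>V. f b j) - f a b)
    + (\<Sum>i\<in>V - {a, b}. \<Sum>j\<in>V - {a, b}. f i j)"
proof -
  have split: "(\<Sum>j\<in>V. h j) = h a + h b + (\<Sum>j\<in>V - {a, b}. h j)" for h :: "'a \<Rightarrow> real"
    using sum.subset_diff[of "{a, b}" V h] fin ab by simp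
  have "f i a = f a i" "f i b = f b i" if "i \<in> V - {a, b}" for i
    using that ab sym by auto
  then have "(\<Sum>i\<in>V - {a, b}. \<Sum>j\<in>V. f i j) = (\<Sum>i\<in>V - {a, b}. f a i) + (\<Sum>i\<in>V - {a, b}. f b i)
      + (\<Sum>i\<in>V - {a, b}. \<Sum>j\<in>V - {a, b}. f i j)"
    by (simp add: split sum.distrib)
  moreover have "(\<Sum>j\<in>V. f a j) = f a b + (\<Sum>j\<in>V - {a, b}. f a j)"
    "(\<Sum>j\<in>V. f b j) = f a b + (\<Sum>j\<in>V - {a, b}. f b j)"
    using split[of "f a"] split[of "f b"] refl sym[OF ab(1,2)] by auto
  ultimately show ?thesis
    using split[of "\<lambda>i. \<Sum>j\<in>V. f i j"] by simp
qed

lemma double_sum_nonneg_eq_0: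
  fixes f :: "'a \<Rightarrow> 'b \<Rightarrow> real"
  assumes "finite A" "finite B" "\<And>i j. \<lbrakk>i \<in> A; j \<in> B\<rbrakk> \<Longrightarrow> 0 \<le> f i j"
    and "(\<Sum>i\<in>A. \<Sum>j\<in>B. f i j) = 0" "i \<in> A" "j \<in> B"
  shows "f i j = 0"
proof -
  have "(\<Sum>j\<in>B. f i j) = 0"
    using assms by (subst (asm) sum_nonneg_eq_0_iff) (auto intro: sum_nonneg)
  then show ?thesis
    using assms by (simp add: sum_nonneg_eq_0_iff)
qed

locale finite_semimetric =
  fixes V :: "'a set" and d :: "'a \<Rightarrow> 'a \<Rightarrow> real"
  assumes fin: "finite V"
    and sym: "\<lbrakk>i \<in> V; j \<in> V\<rbrakk> \<Longrightarrow> d i j = d j i"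
    and refl: "d i i = 0"
    and triangle: "\<lbrakk>i \<in> V; j \<in> V; k \<in> V\<rbrakk> \<Longrightarrow> d i j \<le> d i k + d k j"
begin

definition row :: "'a \<Rightarrow> real" where
  "row i = (\<Sum>j\<in>V. d i j)"

lemma nonneg: "\<lbrakk>i \<in> V; j \<in> V\<rbrakk> \<Longrightarrow> 0 \<le> d i j"
  using triangle[of i i j] sym[of i j] refl[of i] by simp

text \<open>The triangle inequality for \<open>i\<close>, \<open>j\<close> is summed over every
  third point \<open>k\<close> of \<open>V\<close>, with \<open>k = i\<close> and
  \<open>k = j\<close> included.\<close>

lemma card_mult_le_row:
  assumes "i \<in> V" "j \<in> V"
  shows "card V * d i j \<le> row i + row j"
proof -
  have "(\<Sum>k\<in>V. d i j) \<le> (\<Sum>k\<in>V. d i k + d j k)"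
    using assms triangle[of i j] sym by (intro sum_mono) auto
  then show ?thesis
    by (simp add: row_def sum.distrib)
qed

lemma total_split:
  assumes "a \<in> V" "b \<in> V" "a \<noteq> b"
  shows "(\<Sum>i\<in>V. row i) = 2 * (row a + row b - d a b)
    + (\<Sum>i\<in>V - {a, b}. \<Sum>j\<in>V - {a, b}. d i j)"
  unfolding row_def using assms by (intro double_sum_split fin sym refl)

text \<open>The block left over in \<open>total_split\<close> is nonnegative, so the total is at
  least \<open>2 * (row i + row j - d i j)\<close>, and the row bound applies.\<close>

lemma le_total:
  assumes "i \<in> V" "j \<in> V" "i \<noteq> j"
  shows "2 * (real (card V) - 1) * d i j \<le> (\<Sum>i\<in>V. row i)"
proof -
  have "(\<Sum>k\<in>V - {i, j}. \<Sum>l\<in>V - {i, j}. d k l) \<ge> 0"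
    by (intro sum_nonneg nonneg) auto
  then have "2 * (card V * d i j) - 2 * d i j \<le> (\<Sum>i\<in>V. row i)"
    using total_split[OF assms] card_mult_le_row[OF assms(1,2)] by simp
  then show ?thesis
    by (simp add: algebra_simps)
qed

lemma entry_mult_le_total:
  assumes "i \<in> V" "j \<in> V"
  shows "2 * (real (card V) - 1) * (d i j)\<^sup>2 \<le> (\<Sum>i\<in>V. row i) * d i j"
proof (cases "i = j")
  case False
  then show ?thesis
    using mult_right_mono[OF le_total[OF assms False] nonneg[OF assms]]
    by (simp add: power2_eq_square mult.assoc)
qed (simp add: refl)

text \<open>Weighting \<open>le_total\<close> by the entry and summing over all ordered pairs turns
  the right-hand side into the square of the total. Each unordered pair counts twice, so this says
  that \<open>n - 1\<close> times the squared norm is at most the squared coordinate sum.\<close>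

lemma sum_squares_le:
  "2 * (real (card V) - 1) * (\<Sum>i\<in>V. \<Sum>j\<in>V. (d i j)\<^sup>2) \<le> (\<Sum>i\<in>V. row i)\<^sup>2"
proof -
  have "(\<Sum>i\<in>V. \<Sum>j\<in>V. 2 * (real (card V) - 1) * (d i j)\<^sup>2)
      \<le> (\<Sum>i\<in>V. \<Sum>j\<in>V. (\<Sum>i\<in>V. row i) * d i j)"
    by (intro sum_mono entry_mult_le_total)
  also have "\<dots> = (\<Sum>i\<in>V. row i)\<^sup>2"
    by (simp add: power2_eq_square row_def sum_distrib_left)
  finally show ?thesis
    by (simp add: sum_distrib_left)
qed

text \<open>Equality of the sums is equality for each entry, so every entry is \<open>0\<close> or a
  common value \<open>m\<close>. A pair \<open>a\<close>, \<open>b\<close> at distance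
  \<open>m\<close> then makes \<open>le_total\<close> tight: all other points are at distance
  \<open>0\<close> from each other, and every triangle on \<open>a\<close>, \<open>b\<close> is
  degenerate. Hence these points all coincide with the same endpoint, and the other endpoint is
  isolated.\<close>

lemma sum_squares_eq:
  assumes card: "card V \<ge> 3"
    and eq: "2 * (real (card V) - 1) * (\<Sum>i\<in>V. \<Sum>j\<in>V. (d i j)\<^sup>2) = (\<Sum>i\<in>V. row i)\<^sup>2"
    and nonzero: "(\<Sum>i\<in>V. row i) \<noteq> 0"
  obtains a c where "a \<in> V" "c > 0"
    "\<And>i j. \<lbrakk>i \<in> V; j \<in> V\<rbrakk> \<Longrightarrow> d i j = c * of_bool ((i = a) \<noteq> (j = a))"
proof -
  define T where "T = (\<Sum>i\<in>V. row i)"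
  define m where "m = T / (2 * (real (card V) - 1))"
  have n: "real (card V) - 1 > 0" "real (card V) \<ge> 3"
    using card by auto
  have Tm: "T = 2 * (real (card V) - 1) * m"
    using n by (simp add: m_def)
  have "(\<Sum>i\<in>V. \<Sum>j\<in>V. T * d i j - 2 * (real (card V) - 1) * (d i j)\<^sup>2) = 0"
    using eq by (simp add: T_def sum_subtractf power2_eq_square row_def sum_distrib_left)
  moreover have nn: "T * d i j - 2 * (real (card V) - 1) * (d i j)\<^sup>2 \<ge> 0" if "i \<in> V" "j \<in> V" for i j
    using entry_mult_le_total[OF that] by (simp add: T_def)
  ultimately have "T * d i j - 2 * (real (card V) - 1) * (d i j)\<^sup>2 = 0" if "i \<in> V" "j \<in> V" for i j
    using that by (simp add: sum_nonneg_eq_0_iff fin sum_nonneg)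
  then have "2 * (real (card V) - 1) * (d i j * (m - d i j)) = 0" if "i \<in> V" "j \<in> V" for i j
    using that by (simp add: Tm power2_eq_square algebra_simps)
  then have two_valued: "d i j = 0 \<or> d i j = m" if "i \<in> V" "j \<in> V" for i j
    using that n by auto
  obtain a b where ab: "a \<in> V" "b \<in> V" "d a b \<noteq> 0"
    using nonzero unfolding row_def by (meson sum.neutral)
  have dab: "d a b = m" "a \<noteq> b"
    using two_valued ab refl by auto
  have m: "m > 0"
    using nonneg[of a b] ab dab by simp
  define U where "U = V - {a, b}"
  have finU: "finite U" using fin by (simp add: U_def)
  have R_ge: "(\<Sum>i\<in>U. \<Sum>j\<in>U. d i j) \<ge> 0"
    by (intro sum_nonneg nonneg) (auto simp: U_def)
  have "T = 2 * (row a + row b - m) + (\<Sum>i\<in>U. \<Sum>j\<in>U. d i j)"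
    using total_split[OF ab(1,2) dab(2)] dab by (simp add: T_def U_def)
  moreover have "row a + row b \<ge> card V * m"
    using card_mult_le_row[OF ab(1,2)] dab by simp
  ultimately have R0: "(\<Sum>i\<in>U. \<Sum>j\<in>U. d i j) = 0" and rows: "row a + row b = card V * m"
    using Tm R_ge by (simp_all add: algebra_simps)
  have dU: "d i j = 0" if "i \<in> U" "j \<in> U" for i j
    using double_sum_nonneg_eq_0[OF finU finU _ R0 that] nonneg by (auto simp: U_def)
  have "(\<Sum>k\<in>V. d a k + d b k - m) = 0"
    using rows by (simp add: row_def sum.distrib sum_subtractf)
  moreover have "d a k + d b k - m \<ge> 0" if "k \<in> V" for k
    using triangle[of a b k] that ab dab sym by auto
  ultimately have dk: "d a k + d b k = m" if "k \<in> V" for k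
    using that by (simp add: sum_nonneg_eq_0_iff fin)
  have "card U = card V - 2"
    using ab dab by (simp add: U_def card_Diff_subset)
  \<comment> \<open>A third point, available since \<open>card V \<ge> 3\<close>, decides which
    endpoint is the isolated one.\<close>
  then obtain u where u: "u \<in> U"
    using card by fastforce
  have const: "d a k = d a u" if "k \<in> U" for k
    using triangle[of a k u] triangle[of a u k] dU[of u k] dU[of k u] that u ab by (auto simp: U_def)
  \<comment> \<open>Stated for \<open>p\<close>, \<open>q\<close> in either order, since the
    endpoint far from \<open>u\<close> may be \<open>a\<close> or \<open>b\<close>.\<close>
  have star: "d i j = m * of_bool ((i = p) \<noteq> (j = p))"
    if "i \<in> V" "j \<in> V" "{p, q} = {a, b}" "d p u = m" for i j p q
  proof -
    have p: "p \<in> V" "q \<in> V" "p \<noteq> q" "d p q = m" "U = V - {p, q}"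
      using that ab dab sym by (auto simp: U_def doubleton_eq_iff)
    have pk: "d p k = m" "d q k = 0" if "k \<in> U" for k
      using const[OF that] dk[of k] dk[of u] u that \<open>d p u = m\<close> \<open>{p, q} = {a, b}\<close>
      by (auto simp: U_def doubleton_eq_iff)
    show ?thesis
      using that(1,2) p pk sym[of i j] refl dU[of i j] sym[of q p]
      by (cases "i = p"; cases "i = q"; cases "j = p"; cases "j = q") auto
  qed
  have "d a u = m \<or> d b u = m"
    using two_valued[of a u] dk[of u] u ab by (auto simp: U_def)
  then show ?thesis
    using star[of _ _ a b] star[of _ _ b a] ab m that by blast
qed

text \<open>The row sums force the entries to have the same total as their squares, so the values of
  \<open>x * (1 - x)\<close> at the entries sum to zero. By the row bound, entries between
  \<open>{a, b}\<close> and the rest are at most \<open>1\<close>, and entries inside the rest are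
  at most \<open>4 / N\<close>, which is below \<open>1\<close> for \<open>N \<ge> 5\<close>. Only
  \<open>d a b\<close> could contribute negatively, and the block inside the rest compensates for
  it, so the remaining slack vanishes.\<close>

lemma eq_two_point_cut:
  assumes n: "card V \<ge> 5" and ab: "a \<in> V" "b \<in> V" "a \<noteq> b"
    and row_ab: "row a = real (card V) - 2" "row b = real (card V) - 2"
    and row_else: "\<And>i. i \<in> V - {a, b} \<Longrightarrow> row i = 2"
    and sq: "(\<Sum>i\<in>V. \<Sum>j\<in>V. (d i j)\<^sup>2) = 4 * (real (card V) - 2)"
    and ij: "i \<in> V" "j \<in> V"
  shows "d i j = of_bool ((i \<in> {a, b}) \<noteq> (j \<in> {a, b}))"
proof -
  define U where "U = V - {a, b}"
  define N where "N = real (card V)"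
  define t where "t = d a b"
  define h where "h x = x * (1 - x)" for x :: real
  have N: "N \<ge> 5" using n by (simp add: N_def)
  have finU: "finite U" and UV: "\<And>k. k \<in> U \<Longrightarrow> k \<in> V" using fin by (auto simp: U_def)
  have "card U = card V - 2"
    using ab by (simp add: U_def card_Diff_subset)
  then have cU: "real (card U) = N - 2" using n by (simp add: N_def)
  have split: "(\<Sum>j\<in>V. f j) = f a + f b + (\<Sum>j\<in>U. f j)" for f :: "'a \<Rightarrow> real"
    using sum.subset_diff[of "{a, b}" V f] fin ab by (simp add: U_def)
  have t: "0 \<le> t" "N * t \<le> 2 * (N - 2)"
    using nonneg ab card_mult_le_row[OF ab(1,2)] row_ab by (auto simp: t_def N_def)
  have tot: "(\<Sum>i\<in>V. row i) = 4 * (N - 2)"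
    using row_ab row_else cU by (subst split) (simp add: U_def N_def)
  have sumU: "(\<Sum>i\<in>U. \<Sum>j\<in>U. d i j) = 2 * t"
    using total_split[OF ab] row_ab tot by (simp add: U_def N_def t_def)
  have rU: "(\<Sum>k\<in>U. d a k) = N - 2 - t" "(\<Sum>k\<in>U. d b k) = N - 2 - t"
    using row_ab split[of "d a"] split[of "d b"] refl sym[OF ab(1,2)] by (auto simp: row_def N_def t_def)
  have le1: "d a k \<le> 1" "d b k \<le> 1" if "k \<in> U" for k
    using card_mult_le_row[of a k] card_mult_le_row[of b k] that ab row_ab row_else N
    by (auto simp: U_def N_def)
  have leU: "N * d k l \<le> 4" if "k \<in> U" "l \<in> U" for k l
    using card_mult_le_row[of k l] that row_else by (auto simp: U_def N_def)
  have "(\<Sum>i\<in>V. \<Sum>j\<in>V. h (d i j)) = 0"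
    using sq tot by (simp add: h_def right_diff_distrib power2_eq_square sum_subtractf row_def N_def)
  moreover have "(\<Sum>i\<in>V. \<Sum>j\<in>V. h (d i j)) = 2 * ((\<Sum>j\<in>V. h (d a j)) + (\<Sum>j\<in>V. h (d b j)) - h (d a b))
    + (\<Sum>i\<in>U. \<Sum>j\<in>U. h (d i j))"
    unfolding U_def using ab sym by (intro double_sum_split fin) (auto simp: refl h_def)
  ultimately have h0: "2 * h t + 2 * (\<Sum>k\<in>U. h (d a k)) + 2 * (\<Sum>k\<in>U. h (d b k))
      + (\<Sum>i\<in>U. \<Sum>j\<in>U. h (d i j)) = 0"
    using split[of "\<lambda>j. h (d a j)"] split[of "\<lambda>j. h (d b j)"] refl sym[OF ab(1,2)]
    by (simp add: h_def t_def)
  \<comment> \<open>\<open>h \<ge> 0\<close> at all entries except possibly \<open>t\<close>; the entries inside \<open>U\<close> sum to \<open>2 t\<close> and are at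
    most \<open>4 / N < 1\<close>, which compensates a negative \<open>h t\<close>.\<close>
  have hU: "(\<Sum>i\<in>U. \<Sum>j\<in>U. h (d i j)) \<ge> (\<Sum>i\<in>U. \<Sum>j\<in>U. (1 - 4 / N) * d i j)"
  proof (intro sum_mono)
    fix k l assume kl: "k \<in> U" "l \<in> U"
    have "d k l \<le> 4 / N" using leU[OF kl] N by (simp add: field_simps)
    then have "(1 - 4 / N) * d k l \<le> (1 - d k l) * d k l"
      using nonneg kl UV by (intro mult_right_mono) auto
    then show "(1 - 4 / N) * d k l \<le> h (d k l)" by (simp add: h_def mult.commute)
  qed
  have ha: "h (d a k) \<ge> 0" "h (d b k) \<ge> 0" if "k \<in> U" for k
    using le1[OF that] nonneg ab UV[OF that] by (auto simp: h_def)
  have s: "(\<Sum>k\<in>U. h (d a k)) \<ge> 0" "(\<Sum>k\<in>U. h (d b k)) \<ge> 0"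
    using ha by (auto intro: sum_nonneg)
  have hU': "(\<Sum>i\<in>U. \<Sum>j\<in>U. h (d i j)) \<ge> (1 - 4 / N) * (2 * t)"
    using hU by (simp only: sum_distrib_left[symmetric] sumU)
  \<comment> \<open>The row bound for the pair \<open>a\<close>, \<open>b\<close> stops exactly
    where the compensated term for \<open>t\<close> would change sign.\<close>
  have tle: "t \<le> 2 - 4 / N" using t N by (simp add: field_simps)
  then have "t * (2 - 4 / N - t) \<ge> 0" using t by simp
  moreover have ht: "2 * h t + (1 - 4 / N) * (2 * t) = 2 * (t * (2 - 4 / N - t))"
    by (simp add: h_def algebra_simps)
  ultimately have t0: "t * (2 - 4 / N - t) = 0"
    and "(\<Sum>k\<in>U. h (d a k)) = 0" "(\<Sum>k\<in>U. h (d b k)) = 0"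
    using h0 s hU' ht by linarith+
  then have "h (d a k) = 0" "h (d b k) = 0" if "k \<in> U" for k
    using that ha by (auto simp: sum_nonneg_eq_0_iff finU)
  then have zo: "d a k = 0 \<or> d a k = 1" "d b k = 0 \<or> d b k = 1" if "k \<in> U" for k
    using that by (auto simp: h_def)
  \<comment> \<open>The other root \<open>2 - 4 / N\<close> exceeds \<open>1\<close>. As
    \<open>d a k\<close> and \<open>d b k\<close> are \<open>0\<close> or \<open>1\<close>, the
    triangle inequality would then give \<open>d a k = 1\<close> on all of \<open>U\<close>, against
    the sum \<open>N - 2 - t\<close> of these entries.\<close>
  have t_zero: "t = 0"
  proof (rule ccontr)
    assume "t \<noteq> 0"
    then have "t = 2 - 4 / N" using t0 by simp
    moreover have "4 / N < 1" using N by simp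
    ultimately have t1: "t > 1" by linarith
    have "d a k = 1" if "k \<in> U" for k
      using zo[OF that] triangle[of a b k] sym[of k b] ab UV[OF that] t1 by (auto simp: t_def)
    then show False using rU cU \<open>t \<noteq> 0\<close> by simp
  qed
  have "(\<Sum>k\<in>U. 1 - d a k) = 0" "(\<Sum>k\<in>U. 1 - d b k) = 0"
    using rU t_zero cU by (simp_all add: sum_subtractf)
  then have one: "d a k = 1" "d b k = 1" if "k \<in> U" for k
    using that le1 by (auto simp: sum_nonneg_eq_0_iff finU)
  have zero: "d k l = 0" if "k \<in> U" "l \<in> U" for k l
    using double_sum_nonneg_eq_0[OF finU finU _ _ that, of d] sumU t_zero nonneg UV by simp
  show ?thesis
    using ij one[of i] one[of j] zero[of i j] sym[OF ij] sym[OF ab(1,2)] refl t_zero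
    by (cases "i = a"; cases "i = b"; cases "j = a"; cases "j = b") (auto simp: U_def t_def)
qed

end

section \<open>Coordinates and cut vectors\<close>

text \<open>Reads a vector as a symmetric matrix with zero diagonal, so that sums run over the full
  square, at the price of a factor 2, and permutations need not respect
  \<open>i < j\<close>.\<close>

definition entry :: "(nat \<times> nat \<Rightarrow> real) \<Rightarrow> nat \<Rightarrow> nat \<Rightarrow> real" where
  "entry x i j = (if i < j then x (i, j) else if j < i then x (j, i) else 0)"

definition of_entries :: "nat \<Rightarrow> (nat \<Rightarrow> nat \<Rightarrow> real) \<Rightarrow> nat \<times> nat \<Rightarrow> real" where
  "of_entries n f = (\<lambda>(i, j). if (i, j) \<in> pairs n then f i j else 0)"

definition dot :: "'i set \<Rightarrow> ('i \<Rightarrow> real) \<Rightarrow> ('i \<Rightarrow> real) \<Rightarrow> real" where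
  "dot I x y = (\<Sum>i\<in>I. x i * y i)"

definition cut_vector :: "nat \<Rightarrow> nat set \<Rightarrow> nat \<times> nat \<Rightarrow> real" where
  "cut_vector n A = of_entries n (\<lambda>i j. of_bool ((i \<in> A) \<noteq> (j \<in> A)))"

text \<open>Writing \<open>of_bool (i \<noteq> j)\<close> for the constant \<open>1\<close> keeps
  the diagonal zero, as \<open>entry_of_entries\<close> requires.\<close>

definition ones :: "nat \<Rightarrow> nat \<times> nat \<Rightarrow> real" where
  "ones n = of_entries n (\<lambda>i j. of_bool (i \<noteq> j))"

lemma entry_sym: "entry x i j = entry x j i"
  by (auto simp: entry_def)

lemma entry_self [simp]: "entry x i i = 0"
  by (simp add: entry_def)

lemma of_entries_coord [simp]: "of_entries n f \<in> coord_space (pairs n)"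
  by (auto simp: of_entries_def coord_space_def)

lemma cut_coord [simp]: "cut_vector n A \<in> coord_space (pairs n)"
  by (simp add: cut_vector_def)

lemma ones_coord [simp]: "ones n \<in> coord_space (pairs n)"
  by (simp add: ones_def)

lemma entry_of_entries:
  assumes "\<And>i j. f i j = f j i" "\<And>i. f i i = 0" "i \<in> {1..n}" "j \<in> {1..n}"
  shows "entry (of_entries n f) i j = f i j"
  using assms(2-) assms(1)[of j i]
  by (cases i j rule: linorder_cases) (simp_all add: entry_def of_entries_def pairs_def)

lemma entry_cut: "\<lbrakk>i \<in> {1..n}; j \<in> {1..n}\<rbrakk> \<Longrightarrow> entry (cut_vector n A) i j = of_bool ((i \<in> A) \<noteq> (j \<in> A))"
  unfolding cut_vector_def by (subst entry_of_entries) auto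

lemma entry_ones: "\<lbrakk>i \<in> {1..n}; j \<in> {1..n}\<rbrakk> \<Longrightarrow> entry (ones n) i j = of_bool (i \<noteq> j)"
  unfolding ones_def by (subst entry_of_entries) auto

lemma coord_eqI:
  assumes "x \<in> coord_space (pairs n)" "y \<in> coord_space (pairs n)"
    and "\<And>i j. \<lbrakk>i \<in> {1..n}; j \<in> {1..n}; i < j\<rbrakk> \<Longrightarrow> entry x i j = entry y i j"
  shows "x = y"
proof
  fix p :: "nat \<times> nat"
  obtain i j where p: "p = (i, j)"
    by (cases p)
  show "x p = y p"
  proof (cases "p \<in> pairs n")
    case True
    then show ?thesis
      using assms(3)[of i j] by (auto simp: p pairs_def entry_def)
  next
    case False
    then show ?thesis
      using assms(1,2) by (cases p) (simp add: coord_space_def)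
  qed
qed

lemma finite_pairs [simp]: "finite (pairs n)"
  by (rule finite_subset[of _ "{1..n} \<times> {1..n}"]) (auto simp: pairs_def)

lemma sum_pairs:
  fixes f :: "nat \<Rightarrow> nat \<Rightarrow> real"
  assumes sym: "\<And>i j. f i j = f j i" and diag: "\<And>i. f i i = 0"
  shows "2 * (\<Sum>(i, j)\<in>pairs n. f i j) = (\<Sum>i=1..n. \<Sum>j=1..n. f i j)"
proof -
  have "(\<Sum>i=1..n. \<Sum>j=1..n. f i j) = (\<Sum>(i, j)\<in>{1..n} \<times> {1..n}. f i j)"
    by (simp add: sum.cartesian_product)
  also have "\<dots> = (\<Sum>(i, j)\<in>pairs n \<union> (pairs n)\<inverse>. f i j)"
  proof (intro sum.mono_neutral_right ballI)
    fix p assume "p \<in> {1..n} \<times> {1..n} - (pairs n \<union> (pairs n)\<inverse>)"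
    then have "fst p = snd p"
      by (cases p) (auto simp: pairs_def)
    then show "(case p of (i, j) \<Rightarrow> f i j) = 0"
      by (simp add: case_prod_unfold diag)
  next
    show "pairs n \<union> (pairs n)\<inverse> \<subseteq> {1..n} \<times> {1..n}"
      by (auto simp: pairs_def)
  qed simp
  also have "\<dots> = (\<Sum>(i, j)\<in>pairs n. f i j) + (\<Sum>(i, j)\<in>(pairs n)\<inverse>. f i j)"
    by (intro sum.union_disjoint) (simp_all, auto simp: pairs_def)
  also have "(\<Sum>(i, j)\<in>(pairs n)\<inverse>. f i j) = (\<Sum>(i, j)\<in>pairs n. f i j)"
    by (rule sum.reindex_bij_witness[of _ prod.swap prod.swap]) (auto simp: sym)
  finally show ?thesis by simp
qed

lemma dot_pairs: "2 * dot (pairs n) x y = (\<Sum>i=1..n. \<Sum>j=1..n. entry x i j * entry y i j)"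
proof -
  have "dot (pairs n) x y = (\<Sum>(i, j)\<in>pairs n. entry x i j * entry y i j)"
    unfolding dot_def by (intro sum.cong refl) (auto simp: pairs_def entry_def)
  then show ?thesis
    using sum_pairs[of "\<lambda>i j. entry x i j * entry y i j" n] entry_sym by simp
qed

lemma dot_commute: "dot I x y = dot I y x"
  by (simp add: dot_def mult.commute)

text \<open>\<open>\<delta>({i})\<close> is the indicator of the pairs containing \<open>i\<close>.
  Row sums thus become inner products, which isometries preserve.\<close>

lemma dot_cut_singleton:
  assumes i: "i \<in> {1..n}"
  shows "dot (pairs n) x (cut_vector n {i}) = (\<Sum>j=1..n. entry x i j)"
proof -
  have "2 * dot (pairs n) x (cut_vector n {i}) = (\<Sum>k=1..n. \<Sum>l=1..n.
      (if k = i then entry x i l else 0) + (if l = i then entry x k i else 0))"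
    unfolding dot_pairs by (intro sum.cong) (auto simp: entry_cut)
  also have "\<dots> = (\<Sum>k=1..n. if k = i then (\<Sum>l=1..n. entry x i l) else 0) + (\<Sum>k=1..n. entry x k i)"
  proof -
    have "(\<Sum>l=1..n. if k = i then entry x i l else 0) = (if k = i then \<Sum>l=1..n. entry x i l else 0)" for k
      by simp
    then show ?thesis
      using i by (simp add: sum.distrib)
  qed
  also have "\<dots> = 2 * (\<Sum>j=1..n. entry x i j)"
    using i by (simp add: entry_sym[of x _ i])
  finally show ?thesis by simp
qed

lemma dot_ones: "2 * dot (pairs n) x (ones n) = (\<Sum>i=1..n. \<Sum>j=1..n. entry x i j)"
  unfolding dot_pairs by (intro sum.cong) (auto simp: entry_ones)

text \<open>Each pair contains two points, so the cuts \<open>\<delta>({i})\<close> add up to twice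
  the all-ones vector.\<close>

lemma sum_dot_cut_singleton:
  "(\<Sum>i=1..n. dot (pairs n) x (cut_vector n {i})) = 2 * dot (pairs n) x (ones n)"
  unfolding dot_ones by (intro sum.cong) (auto simp: dot_cut_singleton)

text \<open>The row of \<open>i\<close> in \<open>\<delta>(A)\<close> counts the points on the other
  side of the cut. For \<open>A = {i}\<close> this is the squared norm \<open>n - 1\<close>.\<close>

lemma dot_cuts:
  assumes "i \<in> {1..n}"
  shows "dot (pairs n) (cut_vector n A) (cut_vector n {i})
    = (if i \<in> A then real n - card (A \<inter> {1..n}) else card (A \<inter> {1..n}))"
proof -
  have "dot (pairs n) (cut_vector n A) (cut_vector n {i}) = (\<Sum>j=1..n. of_bool ((i \<in> A) \<noteq> (j \<in> A)))"
    using assms by (simp add: dot_cut_singleton entry_cut)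
  also have "\<dots> = (\<Sum>j=1..n. if i \<in> A then 1 - of_bool (j \<in> A) else of_bool (j \<in> A))"
    by (intro sum.cong) auto
  also have "\<dots> = (if i \<in> A then real n - card (A \<inter> {1..n}) else card (A \<inter> {1..n}))"
    by (simp add: sum_subtractf Int_commute)
  finally show ?thesis .
qed

lemma dot_ones_ones: "2 * dot (pairs n) (ones n) (ones n) = real n * (real n - 1)"
proof -
  have "2 * dot (pairs n) (ones n) (ones n) = (\<Sum>i=1..n. dot (pairs n) (ones n) (cut_vector n {i}))"
    by (rule sum_dot_cut_singleton[symmetric])
  also have "\<dots> = (\<Sum>i=1..n. \<Sum>j=1..n. 1 - of_bool (j = i))"
  proof (intro sum.cong refl)
    fix i assume "i \<in> {1..n}"
    then show "dot (pairs n) (ones n) (cut_vector n {i}) = (\<Sum>j=1..n. 1 - of_bool (j = i))"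
      unfolding dot_cut_singleton[OF \<open>i \<in> {1..n}\<close>] by (intro sum.cong refl) (auto simp: entry_ones)
  qed
  also have "\<dots> = (\<Sum>i=1..n. real n - 1)"
    by (intro sum.cong refl) (simp add: sum_subtractf of_bool_def sum.delta)
  finally show ?thesis
    by simp
qed

section \<open>Triangle inequalities and cut vectors in the hypermetric cone\<close>

lemma hypermetric_cone_iff:
  "x \<in> hypermetric_cone n \<longleftrightarrow> x \<in> coord_space (pairs n) \<and>
    (\<forall>b :: nat \<Rightarrow> int. (\<Sum>i=1..n. b i) = (1 :: int) \<longrightarrow> (\<Sum>i=1..n. \<Sum>j=1..n. b i * b j * entry x i j) \<le> 0)"
proof -
  have "2 * (\<Sum>(i, j)\<in>pairs n. real_of_int (b i * b j) * x (i, j))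
      = (\<Sum>i=1..n. \<Sum>j=1..n. b i * b j * entry x i j)" for b :: "nat \<Rightarrow> int"
    by (subst sum_pairs[symmetric])
      (auto simp: entry_sym entry_def pairs_def intro!: sum.cong)
  note eq = this
  have "(\<Sum>(i, j)\<in>pairs n. real_of_int (b i * b j) * x (i, j)) \<le> 0 \<longleftrightarrow>
      (\<Sum>i=1..n. \<Sum>j=1..n. b i * b j * entry x i j) \<le> 0" for b :: "nat \<Rightarrow> int"
    unfolding eq[of b, symmetric] by simp
  then show ?thesis
    by (simp add: hypermetric_cone_def)
qed

lemma hypermetric_cone_coord: "x \<in> hypermetric_cone n \<Longrightarrow> x \<in> coord_space (pairs n)"
  by (simp add: hypermetric_cone_def)

text \<open>This is the hypermetric inequality for the integer vector with values \<open>1\<close>,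
  \<open>1\<close>, \<open>-1\<close> at \<open>i\<close>, \<open>j\<close>, \<open>k\<close> and
  \<open>0\<close> elsewhere.\<close>

lemma hypermetric_cone_triangle:
  assumes x: "x \<in> hypermetric_cone n" and ijk: "{i, j, k} \<subseteq> {1..n}" "distinct [i, j, k]"
  shows "entry x i j \<le> entry x i k + entry x k j"
proof -
  define b :: "nat \<Rightarrow> int" where "b p = of_bool (p = i) + of_bool (p = j) - of_bool (p = k)" for p
  have b: "(\<Sum>p=1..n. b p * f p) = f i + f j - f k" for f :: "nat \<Rightarrow> real"
  proof -
    have "(\<Sum>p=1..n. b p * f p) = (\<Sum>p=1..n. (if p = i then f p else 0) + (if p = j then f p else 0)
        - (if p = k then f p else 0))"
      by (intro sum.cong) (auto simp: b_def)
    then show ?thesis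
      using ijk by (simp add: sum.distrib sum_subtractf)
  qed
  have "real_of_int (\<Sum>p=1..n. b p) = 1"
    using b[of "\<lambda>_. 1"] by simp
  then have "(\<Sum>p=1..n. b p) = 1"
    by linarith
  then have "(\<Sum>p=1..n. \<Sum>q=1..n. b p * b q * entry x p q) \<le> 0"
    using x by (simp add: hypermetric_cone_iff)
  also have "(\<Sum>p=1..n. \<Sum>q=1..n. b p * b q * entry x p q)
      = (\<Sum>p=1..n. b p * (\<Sum>q=1..n. b q * entry x p q))"
    by (simp add: sum_distrib_left mult.assoc)
  finally show ?thesis
    unfolding b using entry_sym[of x j i] entry_sym[of x k i] entry_sym[of x k j] by simp
qed

lemma hypermetric_cone_semimetric:
  assumes x: "x \<in> hypermetric_cone n" and n: "n \<ge> 3"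
  shows "finite_semimetric {1..n} (entry x)"
proof
  \<comment> \<open>Since \<open>n \<ge> 3\<close> there is a third point \<open>l\<close>. In the
    sum of the triangle inequalities for \<open>i\<close>, \<open>l\<close> through \<open>k\<close>
    and for \<open>l\<close>, \<open>k\<close> through \<open>i\<close>, the distances to
    \<open>l\<close> cancel except for a common term, leaving
    \<open>0 \<le> 2 * entry x i k\<close>.\<close>
  have nonneg: "0 \<le> entry x i k" if ik: "i \<in> {1..n}" "k \<in> {1..n}" "i \<noteq> k" for i k
  proof -
    have "card ({1..n} - {i, k}) > 0"
      using n ik by (simp add: card_Diff_subset)
    then obtain l where "l \<in> {1..n} - {i, k}"
      by (metis card_gt_0_iff ex_in_conv)
    then show ?thesis
      using hypermetric_cone_triangle[OF x, of i l k] hypermetric_cone_triangle[OF x, of l k i]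
        ik entry_sym[of x] by simp
  qed
  fix i j k assume ijk: "i \<in> {1..n}" "j \<in> {1..n}" "k \<in> {1..n}"
  show "entry x i j \<le> entry x i k + entry x k j"
  proof (cases "distinct [i, j, k]")
    case True
    then show ?thesis using hypermetric_cone_triangle[OF x _ True] ijk by simp
  next
    case False
    then show ?thesis
      using nonneg[of i k] ijk entry_sym[of x k i] by (cases "i = k"; cases "k = j") auto
  qed
qed (simp_all, rule entry_sym)

text \<open>Integrality of \<open>b\<close> enters here: \<open>k * (1 - k)\<close> is positive only
  strictly between \<open>0\<close> and \<open>1\<close>. It puts all cut vectors into the
  cone.\<close>

lemma int_mult_one_minus_le_0: "real_of_int k * (1 - k) \<le> 0"
proof -
  have "k * (1 - k) \<le> 0"
    by (cases "k \<le> 0") (auto simp: mult_le_0_iff)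
  then show ?thesis
    by (metis of_int_1 of_int_diff of_int_le_0_iff of_int_mult)
qed

text \<open>With \<open>a\<close> the indicator of \<open>A\<close>, the cut entry is
  \<open>a i + a j - 2 * a i * a j\<close>, so the form depends only on the total weight of
  \<open>b\<close> and its weight on \<open>A\<close>.\<close>

lemma sum_cut:
  fixes b :: "nat \<Rightarrow> real"
  assumes b: "(\<Sum>i=1..n. b i) = 1"
  shows "(\<Sum>i=1..n. \<Sum>j=1..n. b i * b j * entry (cut_vector n A) i j)
    = 2 * ((\<Sum>i\<in>A \<inter> {1..n}. b i) * (1 - (\<Sum>i\<in>A \<inter> {1..n}. b i)))"
proof -
  define s where "s = (\<Sum>i\<in>A \<inter> {1..n}. b i)"
  define c where "c i = b i * of_bool (i \<in> A)" for i
  have c: "(\<Sum>i=1..n. c i) = s"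
    by (simp add: s_def c_def of_bool_def if_distrib sum.If_cases Int_commute cong: if_cong)
  have "(\<Sum>i=1..n. \<Sum>j=1..n. b i * b j * entry (cut_vector n A) i j)
      = (\<Sum>i=1..n. \<Sum>j=1..n. c i * b j + b i * c j - 2 * (c i * c j))"
    by (intro sum.cong) (auto simp: entry_cut c_def)
  also have "\<dots> = (\<Sum>i=1..n. c i) * (\<Sum>i=1..n. b i) + (\<Sum>i=1..n. b i) * (\<Sum>i=1..n. c i)
      - 2 * ((\<Sum>i=1..n. c i) * (\<Sum>i=1..n. c i))"
    unfolding sum_product by (simp add: sum.distrib sum_subtractf sum_distrib_left)
  also have "\<dots> = 2 * (s * (1 - s))"
    unfolding c b by (simp add: algebra_simps)
  finally show ?thesis by (simp add: s_def)
qed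

lemma cut_hypermetric: "cut_vector n A \<in> hypermetric_cone n"
proof -
  have "(\<Sum>i=1..n. \<Sum>j=1..n. b i * b j * entry (cut_vector n A) i j) \<le> 0"
    if "(\<Sum>i=1..n. b i) = (1 :: int)" for b
  proof -
    have "(\<Sum>i=1..n. real_of_int (b i)) = 1"
      using that by (metis of_int_1 of_int_sum)
    then show ?thesis
      using int_mult_one_minus_le_0[of "\<Sum>i\<in>A \<inter> {1..n}. b i"]
        sum_cut[of "\<lambda>i. real_of_int (b i)" n A] by simp
  qed
  then show ?thesis
    by (simp add: hypermetric_cone_iff)
qed

section \<open>Linear isometries\<close>

lemma dot_self_nonneg: "0 \<le> dot I x x"
  by (simp add: dot_def sum_nonneg)

lemma euclid_dist_eq_sqrt: "euclid_dist I x y = sqrt (dot I (\<lambda>i. x i - y i) (\<lambda>i. x i - y i))"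
  by (simp add: euclid_dist_def L2_set_def dot_def power2_eq_square)

lemma dot_diff_diff: "dot I (\<lambda>i. x i - y i) (\<lambda>i. x i - y i) = dot I x x - 2 * dot I x y + dot I y y"
  by (simp add: dot_def sum.distrib sum_subtractf sum_distrib_left algebra_simps)

lemma coord_space_closed [simp]:
  "(\<lambda>_. 0) \<in> coord_space I"
  "\<lbrakk>x \<in> coord_space I; y \<in> coord_space I\<rbrakk> \<Longrightarrow> (\<lambda>i. x i + y i) \<in> coord_space I"
  "\<lbrakk>x \<in> coord_space I; y \<in> coord_space I\<rbrakk> \<Longrightarrow> (\<lambda>i. x i - y i) \<in> coord_space I"
  "x \<in> coord_space I \<Longrightarrow> (\<lambda>i. c * x i) \<in> coord_space I"
  by (auto simp: coord_space_def)

lemma dot_self_eq_0: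
  assumes "finite I" "x \<in> coord_space I" "dot I x x \<le> 0"
  shows "x = (\<lambda>_. 0)"
proof -
  have "(\<Sum>i\<in>I. x i * x i) = 0"
    using assms(3) dot_self_nonneg[of I x] by (simp add: dot_def)
  then have "x i = 0" if "i \<in> I" for i
    using that assms(1) by (simp add: sum_nonneg_eq_0_iff)
  then show ?thesis
    using assms(2) by (auto simp: coord_space_def)
qed

context
  fixes I :: "'i set" and g :: "('i \<Rightarrow> real) \<Rightarrow> 'i \<Rightarrow> real"
  assumes g: "g \<in> linear_transformations I"
begin

lemma linear_coord: "x \<in> coord_space I \<Longrightarrow> g x \<in> coord_space I"
  using g unfolding linear_transformations_def by blast

lemma linear_undefined: "x \<notin> coord_space I \<Longrightarrow> g x = undefined"
  using g unfolding linear_transformations_def by (blast dest: PiE_arb)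

lemma linear_add:
  "\<lbrakk>x \<in> coord_space I; y \<in> coord_space I\<rbrakk> \<Longrightarrow> g (\<lambda>i. x i + y i) = (\<lambda>i. g x i + g y i)"
  using g by (simp add: linear_transformations_def)

lemma linear_scale: "x \<in> coord_space I \<Longrightarrow> g (\<lambda>i. c * x i) = (\<lambda>i. c * g x i)"
  using g by (simp add: linear_transformations_def)

lemma linear_zero: "g (\<lambda>_. 0) = (\<lambda>_. 0)"
  using linear_scale[of "\<lambda>_. 0" 0] by simp

lemma linear_diff:
  assumes "x \<in> coord_space I" "y \<in> coord_space I"
  shows "g (\<lambda>i. x i - y i) = (\<lambda>i. g x i - g y i)"
  using linear_add[of x "\<lambda>i. - 1 * y i"] linear_scale[of y "- 1"] assms
  by (simp add: coord_space_def)

end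

lemma linear_eqI:
  fixes I :: "'i set"
  assumes fin: "finite I" and g: "g \<in> linear_transformations I" and h: "h \<in> linear_transformations I"
    and eq: "\<And>p. p \<in> I \<Longrightarrow> g (\<lambda>i. of_bool (i = p)) = h (\<lambda>i. of_bool (i = p))"
  shows "g = h"
proof
  fix x
  show "g x = h x"
  proof (cases "x \<in> coord_space I")
    case True
    have "g (\<lambda>i. if i \<in> F then x i else 0) = h (\<lambda>i. if i \<in> F then x i else 0)"
      if "finite F" "F \<subseteq> I" for F
      using that
    proof (induction F rule: finite_induct)
      case empty
      then show ?case by (simp add: linear_zero[OF g] linear_zero[OF h])
    next
      case (insert p F)
      let ?y = "\<lambda>i. if i \<in> F then x i else 0" and ?e = "\<lambda>i. of_bool (i = p) :: real"
      have "?y \<in> coord_space I" "?e \<in> coord_space I"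
        using insert.prems by (auto simp: coord_space_def)
      moreover have "(\<lambda>i. if i \<in> insert p F then x i else 0) = (\<lambda>i. ?y i + x p * ?e i)"
        using insert.hyps by auto
      ultimately show ?case
        using insert.IH insert.prems eq[of p]
        by (simp add: linear_add[OF g] linear_add[OF h] linear_scale[OF g] linear_scale[OF h])
    qed
    from this[OF fin subset_refl] have "g (\<lambda>i. if i \<in> I then x i else 0) = h (\<lambda>i. if i \<in> I then x i else 0)" .
    moreover have "(\<lambda>i. if i \<in> I then x i else 0) = x"
      using True by (auto simp: coord_space_def)
    ultimately show ?thesis
      by simp
  next
    case False
    then show ?thesis
      by (simp add: linear_undefined[OF g] linear_undefined[OF h])
  qed
qed

text \<open>A linear map fixes \<open>0\<close>, so distances to \<open>0\<close> give norms.
  Polarizing the norm of \<open>x - y\<close> then gives inner products.\<close>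

lemma symmetry_groupD:
  assumes "g \<in> carrier (symmetry_group I P)"
  shows "g \<in> linear_transformations I" "g ` P = P"
    and "\<lbrakk>x \<in> coord_space I; y \<in> coord_space I\<rbrakk> \<Longrightarrow> dot I (g x) (g y) = dot I x y"
proof -
  show lin: "g \<in> linear_transformations I" and "g ` P = P"
    using assms by (simp_all add: symmetry_group_def)
  have sq: "dot I (g x) (g x) = dot I x x" if "x \<in> coord_space I" for x
  proof -
    have "euclid_dist I (g x) (g (\<lambda>_. 0)) = euclid_dist I x (\<lambda>_. 0)"
      using assms that by (simp add: symmetry_group_def)
    then show ?thesis
      by (simp add: euclid_dist_eq_sqrt linear_zero[OF lin])
  qed
  show "dot I (g x) (g y) = dot I x y" if "x \<in> coord_space I" "y \<in> coord_space I"
    using sq[of "\<lambda>i. x i - y i"] sq[of x] sq[of y] that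
    by (simp add: linear_diff[OF lin] dot_diff_diff)
qed

lemma symmetry_groupI:
  assumes lin: "g \<in> linear_transformations I"
    and "\<And>x. x \<in> coord_space I \<Longrightarrow> dot I (g x) (g x) = dot I x x" "g ` P = P"
  shows "g \<in> carrier (symmetry_group I P)"
proof -
  have "euclid_dist I (g x) (g y) = euclid_dist I x y" if "x \<in> coord_space I" "y \<in> coord_space I" for x y
    unfolding euclid_dist_eq_sqrt linear_diff[OF lin that, symmetric] using that assms(2) by simp
  then show ?thesis
    using assms by (simp add: symmetry_group_def)
qed

lemma mult_symmetry_group: "g \<otimes>\<^bsub>symmetry_group I P\<^esub> h = compose (coord_space I) g h"
  by (simp add: symmetry_group_def)

text \<open>The three cuts cancel on every pair other than \<open>{i, j}\<close>. Hence cuts by one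
  or two points span the space, and a linear map is known from its values on them.\<close>

lemma unit_vector_eq_cuts:
  assumes "(i, j) \<in> pairs n"
  shows "(\<lambda>p. of_bool (p = (i, j)))
    = (\<lambda>p. 1 / 2 * (cut_vector n {i} p + cut_vector n {j} p - cut_vector n {i, j} p))"
  using assms by (auto simp: fun_eq_iff cut_vector_def of_entries_def pairs_def)

lemma linear_eqI_cuts:
  assumes g: "g \<in> linear_transformations (pairs n)" and h: "h \<in> linear_transformations (pairs n)"
    and single: "\<And>i. i \<in> {1..n} \<Longrightarrow> g (cut_vector n {i}) = h (cut_vector n {i})"
    and double: "\<And>i j. \<lbrakk>i \<in> {1..n}; j \<in> {1..n}; i < j\<rbrakk> \<Longrightarrow> g (cut_vector n {i, j}) = h (cut_vector n {i, j})"
  shows "g = h"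
proof (rule linear_eqI[OF finite_pairs g h])
  fix p assume "p \<in> pairs n"
  moreover obtain i j where p: "p = (i, j)" by (cases p)
  ultimately have ij: "(i, j) \<in> pairs n" "i \<in> {1..n}" "j \<in> {1..n}" "i < j"
    by (auto simp: pairs_def)
  show "g (\<lambda>q. of_bool (q = p)) = h (\<lambda>q. of_bool (q = p))"
  proof -
    have "k (\<lambda>q. 1 / 2 * (cut_vector n {i} q + cut_vector n {j} q - cut_vector n {i, j} q))
      = (\<lambda>q. 1 / 2 * (k (cut_vector n {i}) q + k (cut_vector n {j}) q - k (cut_vector n {i, j}) q))"
      if k: "k \<in> linear_transformations (pairs n)" for k
      by (subst linear_scale[OF k], simp, subst linear_diff[OF k], simp, simp,
          subst linear_add[OF k], simp_all only: cut_coord)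
    from this[OF g] this[OF h] show ?thesis
      unfolding p unit_vector_eq_cuts[OF ij(1)] single[OF ij(2)] single[OF ij(3)] double[OF ij(2-)]
      by (rule trans[OF _ sym])
  qed
qed

section \<open>The norm bound on the cone and its equality case\<close>

lemma dot_ones_sq_ge:
  assumes x: "x \<in> hypermetric_cone n" and n: "n \<ge> 3"
  shows "(real n - 1) * dot (pairs n) x x \<le> (dot (pairs n) x (ones n))\<^sup>2" "0 \<le> dot (pairs n) x (ones n)"
proof -
  interpret finite_semimetric "{1..n}" "entry x"
    by (rule hypermetric_cone_semimetric[OF x n])
  have total: "(\<Sum>i=1..n. row i) = 2 * dot (pairs n) x (ones n)"
    by (simp only: row_def dot_ones)
  have squares: "(\<Sum>i=1..n. \<Sum>j=1..n. (entry x i j)\<^sup>2) = 2 * dot (pairs n) x x"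
    by (simp only: dot_pairs power2_eq_square)
  show "(real n - 1) * dot (pairs n) x x \<le> (dot (pairs n) x (ones n))\<^sup>2"
    using sum_squares_le unfolding total squares by (simp add: power_mult_distrib algebra_simps)
  have "0 \<le> (\<Sum>i=1..n. row i)"
    unfolding row_def by (intro sum_nonneg nonneg)
  then show "0 \<le> dot (pairs n) x (ones n)"
    unfolding total by simp
qed

text \<open>The equality case gives a positive multiple of a cut \<open>\<delta>({a})\<close>, and
  the prescribed coordinate sum \<open>n - 1\<close> makes the factor \<open>1\<close>.\<close>

lemma dot_ones_sq_eq:
  assumes x: "x \<in> hypermetric_cone n" and n: "n \<ge> 3"
    and eq: "(real n - 1) * dot (pairs n) x x = (dot (pairs n) x (ones n))\<^sup>2"
    and total_x: "dot (pairs n) x (ones n) = real n - 1"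
  obtains i where "i \<in> {1..n}" "x = cut_vector n {i}"
proof -
  interpret finite_semimetric "{1..n}" "entry x"
    by (rule hypermetric_cone_semimetric[OF x n])
  have total: "(\<Sum>i=1..n. row i) = 2 * dot (pairs n) x (ones n)"
    by (simp only: row_def dot_ones)
  have squares: "(\<Sum>i=1..n. \<Sum>j=1..n. (entry x i j)\<^sup>2) = 2 * dot (pairs n) x x"
    by (simp only: dot_pairs power2_eq_square)
  have nonzero: "(\<Sum>i=1..n. row i) \<noteq> 0"
    unfolding total total_x using n by simp
  obtain a c where a: "a \<in> {1..n}"
    and d: "\<And>i j. \<lbrakk>i \<in> {1..n}; j \<in> {1..n}\<rbrakk> \<Longrightarrow> entry x i j = c * of_bool ((i = a) \<noteq> (j = a))"
  proof (rule sum_squares_eq)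
    show "2 * (real (card {1..n}) - 1) * (\<Sum>i=1..n. \<Sum>j=1..n. (entry x i j)\<^sup>2) = (\<Sum>i=1..n. row i)\<^sup>2"
      unfolding total squares using eq by (simp add: power_mult_distrib algebra_simps)
  qed (use n nonzero in auto)
  have "x = (\<lambda>p. c * cut_vector n {a} p)"
  proof (rule coord_eqI)
    fix i j assume ij: "i \<in> {1..n}" "j \<in> {1..n}" "i < j"
    then show "entry x i j = entry (\<lambda>p. c * cut_vector n {a} p) i j"
      using d[OF ij(1,2)] entry_cut[OF ij(1,2), of "{a}"] by (simp add: entry_def)
  qed (use x in \<open>simp_all add: hypermetric_cone_coord\<close>)
  moreover from this have "dot (pairs n) x (ones n) = c * dot (pairs n) (cut_vector n {a}) (ones n)"
    by (simp add: dot_def sum_distrib_left mult.assoc)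
  moreover have "dot (pairs n) (cut_vector n {a}) (ones n) = real n - 1"
  proof -
    have "2 * dot (pairs n) (cut_vector n {a}) (ones n) = (\<Sum>i=1..n. if i = a then real n - 1 else 1)"
      unfolding sum_dot_cut_singleton[symmetric] using a by (intro sum.cong refl) (auto simp: dot_cuts)
    also have "\<dots> = (\<Sum>i=1..n. (if i = a then real n - 2 else 0) + 1)"
      by (intro sum.cong) auto
    also have "\<dots> = 2 * (real n - 1)"
      using a by (simp add: sum.distrib)
    finally show ?thesis by simp
  qed
  ultimately have "c = 1"
    using total_x n by simp
  then show thesis
    using that[OF a] \<open>x = _\<close> by simp
qed

section \<open>Symmetries of the cone for \<open>n \<ge> 5\<close>\<close>

text \<open>For \<open>i \<noteq> j\<close> the two cuts share only the pair \<open>{i, j}\<close>,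
  while each has squared norm \<open>n - 1 > 1\<close>.\<close>

lemma cut_singleton_inject:
  assumes n: "n \<ge> 3" and ij: "i \<in> {1..n}" "j \<in> {1..n}" and eq: "cut_vector n {i} = cut_vector n {j}"
  shows "i = j"
proof (rule ccontr)
  assume "i \<noteq> j"
  then have "dot (pairs n) (cut_vector n {i}) (cut_vector n {j}) = 1"
    using ij by (subst dot_cuts) auto
  moreover have "dot (pairs n) (cut_vector n {j}) (cut_vector n {j}) = real n - 1"
    using ij by (subst dot_cuts) auto
  ultimately show False
    using n unfolding eq by simp
qed

lemma image_permutes:
  assumes "finite S" "inj_on c S" "inj_on g (c ` S)" "\<And>i. i \<in> S \<Longrightarrow> \<exists>j\<in>S. g (c i) = c j"
  obtains \<sigma> where "\<sigma> permutes S" "\<And>i. i \<in> S \<Longrightarrow> g (c i) = c (\<sigma> i)"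
proof -
  obtain f where f: "f i \<in> S" "g (c i) = c (f i)" if "i \<in> S" for i
    using assms(4) by metis
  \<comment> \<open>The default \<open>i\<close> outside \<open>S\<close> is what
    \<open>permutes\<close> demands.\<close>
  define \<sigma> where "\<sigma> i = (if i \<in> S then f i else i)" for i
  have \<sigma>: "g (c i) = c (\<sigma> i)" if "i \<in> S" for i
    using f that by (simp add: \<sigma>_def)
  have "inj_on \<sigma> S"
  proof (rule inj_onI)
    fix i j assume ij: "i \<in> S" "j \<in> S" "\<sigma> i = \<sigma> j"
    then have "g (c i) = g (c j)"
      by (simp only: \<sigma>)
    then show "i = j"
      using ij assms(2,3) by (simp add: inj_on_eq_iff)
  qed
  moreover have "\<sigma> ` S \<subseteq> S"
    using f(1) by (auto simp: \<sigma>_def)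
  ultimately have "bij_betw \<sigma> S S"
    using assms(1) by (simp add: bij_betw_def endo_inj_surj)
  then have "\<sigma> permutes S"
    by (rule bij_imp_permutes) (auto simp: \<sigma>_def)
  then show thesis
    using \<sigma> that by blast
qed

section \<open>Action of a symmetry on the all-ones vector and the one-point cuts\<close>

context
  fixes n :: nat and g :: "(nat \<times> nat \<Rightarrow> real) \<Rightarrow> nat \<times> nat \<Rightarrow> real"
  assumes n: "n \<ge> 3" and g: "g \<in> carrier (symmetry_group (pairs n) (hypermetric_cone n))"
begin

lemma symmetry_coord: "x \<in> coord_space (pairs n) \<Longrightarrow> g x \<in> coord_space (pairs n)"
  by (rule linear_coord[OF symmetry_groupD(1)[OF g]])

lemma symmetry_dot:
  "\<lbrakk>x \<in> coord_space (pairs n); y \<in> coord_space (pairs n)\<rbrakk> \<Longrightarrow> dot (pairs n) (g x) (g y) = dot (pairs n) x y"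
  by (rule symmetry_groupD(3)[OF g])

lemma symmetry_cut_hypermetric: "g (cut_vector n A) \<in> hypermetric_cone n"
  using symmetry_groupD(2)[OF g] cut_hypermetric by blast

lemma symmetry_ones: "g (ones n) = ones n"
proof -
  have n1: "real n - 1 > 0"
    using n by simp
  have ge: "dot (pairs n) (g (ones n)) (cut_vector n {i}) \<ge> real n - 1" if i: "i \<in> {1..n}" for i
  proof -
    \<comment> \<open>The norm bound is applied to the preimage \<open>y\<close> of
      \<open>\<delta>({i})\<close>: its coordinate sum equals the inner product of
      \<open>g (ones n)\<close> with \<open>\<delta>({i})\<close>, as \<open>g\<close> preserves
      inner products.\<close>
    obtain y where y: "y \<in> hypermetric_cone n" "cut_vector n {i} = g y"
      using symmetry_groupD(2)[OF g] cut_hypermetric by blast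
    have yc: "y \<in> coord_space (pairs n)"
      by (rule hypermetric_cone_coord[OF y(1)])
    have "dot (pairs n) y y = dot (pairs n) (cut_vector n {i}) (cut_vector n {i})"
      using symmetry_dot[OF yc yc] y by simp
    also have "\<dots> = real n - 1"
      using i by (simp add: dot_cuts)
    finally have "(real n - 1)\<^sup>2 \<le> (dot (pairs n) y (ones n))\<^sup>2"
      using dot_ones_sq_ge(1)[OF y(1) n] by (simp add: power2_eq_square)
    then have "real n - 1 \<le> dot (pairs n) y (ones n)"
      by (rule power2_le_imp_le) (rule dot_ones_sq_ge(2)[OF y(1) n])
    also have "\<dots> = dot (pairs n) (g (ones n)) (cut_vector n {i})"
      using symmetry_dot[OF ones_coord yc] y by (simp add: dot_commute)
    finally show ?thesis .
  qed
  have "2 * dot (pairs n) (ones n) (ones n) = (\<Sum>i=1..n. real n - 1)"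
    by (simp add: dot_ones_ones)
  also have "\<dots> \<le> (\<Sum>i=1..n. dot (pairs n) (g (ones n)) (cut_vector n {i}))"
    by (intro sum_mono ge)
  also have "\<dots> = 2 * dot (pairs n) (g (ones n)) (ones n)"
    by (rule sum_dot_cut_singleton)
  \<comment> \<open>Because \<open>g (ones n)\<close> and \<open>ones n\<close> have equal norms,
    their squared distance is twice the squared norm of \<open>ones n\<close> minus twice their
    inner product.\<close>
  finally have "dot (pairs n) (\<lambda>i. g (ones n) i - ones n i) (\<lambda>i. g (ones n) i - ones n i) \<le> 0"
    by (simp add: dot_diff_diff symmetry_dot)
  then have "(\<lambda>i. g (ones n) i - ones n i) = (\<lambda>_. 0)"
    by (intro dot_self_eq_0[OF finite_pairs]) (simp_all add: symmetry_coord)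
  then show ?thesis
    by (auto simp: fun_eq_iff)
qed

text \<open>The image keeps its squared norm and, the all-ones vector being fixed, its coordinate
  sum. Both equal \<open>n - 1\<close>, which is the equality case of the norm bound.\<close>

lemma symmetry_cut_singleton:
  assumes i: "i \<in> {1..n}"
  shows "\<exists>j\<in>{1..n}. g (cut_vector n {i}) = cut_vector n {j}"
proof -
  have "dot (pairs n) (g (cut_vector n {i})) (ones n) = dot (pairs n) (cut_vector n {i}) (ones n)"
    using symmetry_dot[OF cut_coord ones_coord] by (simp only: symmetry_ones)
  also have "\<dots> = (\<Sum>j=1..n. entry (ones n) i j)"
    using i by (simp only: dot_commute[of _ "cut_vector n {i}"] dot_cut_singleton)
  also have "\<dots> = (\<Sum>j=1..n. 1 - (if j = i then 1 else 0))"
    using i by (intro sum.cong refl) (auto simp: entry_ones)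
  also have "\<dots> = real n - 1"
    using i by (simp add: sum_subtractf)
  finally have total: "dot (pairs n) (g (cut_vector n {i})) (ones n) = real n - 1" .
  have "dot (pairs n) (g (cut_vector n {i})) (g (cut_vector n {i})) = real n - 1"
    using i by (simp add: symmetry_dot dot_cuts)
  then show ?thesis
    using dot_ones_sq_eq[OF symmetry_cut_hypermetric n _ total] total
    by (metis power2_eq_square)
qed

lemma symmetry_inj: "inj_on g (coord_space (pairs n))"
proof (rule inj_onI)
  fix x y assume xy: "x \<in> coord_space (pairs n)" "y \<in> coord_space (pairs n)" "g x = g y"
  then have "dot (pairs n) (\<lambda>p. x p - y p) (\<lambda>p. x p - y p) = 0"
    using symmetry_dot[of x x] symmetry_dot[of x y] symmetry_dot[of y y] by (simp add: dot_diff_diff)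
  then have "(\<lambda>p. x p - y p) = (\<lambda>_. 0)"
    using xy by (intro dot_self_eq_0[OF finite_pairs[of n]]) simp_all
  then show "x = y"
    by (simp add: fun_eq_iff)
qed

lemma symmetry_permutes_cuts:
  obtains \<sigma> where "\<sigma> permutes {1..n}"
    "\<And>i. i \<in> {1..n} \<Longrightarrow> g (cut_vector n {i}) = cut_vector n {\<sigma> i}"
proof -
  have "inj_on g ((\<lambda>i. cut_vector n {i}) ` {1..n})"
    by (rule inj_on_subset[OF symmetry_inj]) auto
  moreover have "inj_on (\<lambda>i. cut_vector n {i}) {1..n}"
    by (rule inj_onI) (rule cut_singleton_inject[OF n])
  ultimately show thesis
    using image_permutes[of "{1..n}" "\<lambda>i. cut_vector n {i}" g] symmetry_cut_singleton that by blast
qed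

end

text \<open>Row sums are inner products with one-point cuts, which \<open>g\<close> permutes by
  \<open>\<sigma>\<close>. So the image has the row sums of the expected cut, and also its norm, and
  \<open>eq_two_point_cut\<close> identifies it.\<close>

lemma symmetry_cut_pair:
  assumes n: "n \<ge> 5" and g: "g \<in> carrier (symmetry_group (pairs n) (hypermetric_cone n))"
    and perm: "\<sigma> permutes {1..n}"
    and single: "\<And>i. i \<in> {1..n} \<Longrightarrow> g (cut_vector n {i}) = cut_vector n {\<sigma> i}"
    and ij: "i \<in> {1..n}" "j \<in> {1..n}" "i \<noteq> j"
  shows "g (cut_vector n {i, j}) = cut_vector n {\<sigma> i, \<sigma> j}"
proof (rule coord_eqI)
  have n3: "n \<ge> 3" using n by simp
  let ?x = "g (cut_vector n {i, j})"
  interpret finite_semimetric "{1..n}" "entry ?x"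
    by (rule hypermetric_cone_semimetric[OF symmetry_cut_hypermetric[OF n3 g] n3])
  have card: "card ({i, j} \<inter> {1..n}) = 2"
    using ij by simp
  have row: "row (\<sigma> k) = (if k \<in> {i, j} then real n - 2 else 2)" if k: "k \<in> {1..n}" for k
  proof -
    have \<sigma>k: "\<sigma> k \<in> {1..n}"
      using permutes_in_image[OF perm] k by simp
    have "row (\<sigma> k) = dot (pairs n) ?x (g (cut_vector n {k}))"
      unfolding row_def single[OF k] dot_cut_singleton[OF \<sigma>k] ..
    also have "\<dots> = dot (pairs n) (cut_vector n {i, j}) (cut_vector n {k})"
      by (simp add: symmetry_dot[OF n3 g])
    finally show ?thesis
      unfolding dot_cuts[OF k] card by simp
  qed
  have rowi: "row (\<sigma> i) = real (card {1..n}) - 2" "row (\<sigma> j) = real (card {1..n}) - 2"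
    using row[OF ij(1)] row[OF ij(2)] by simp_all
  have row2: "row k = 2" if "k \<in> {1..n} - {\<sigma> i, \<sigma> j}" for k
  proof -
    have "inv' \<sigma> k \<in> {1..n}" "\<sigma> (inv' \<sigma> k) = k"
      using that permutes_in_image[OF permutes_inv[OF perm]] permutes_inverses[OF perm] by auto
    then show ?thesis
      using row[of "inv' \<sigma> k"] that by auto
  qed
  have "(\<Sum>k=1..n. \<Sum>l=1..n. (entry ?x k l)\<^sup>2) = 2 * dot (pairs n) ?x ?x"
    by (simp only: dot_pairs power2_eq_square)
  also have "\<dots> = 2 * dot (pairs n) (cut_vector n {i, j}) (cut_vector n {i, j})"
    by (simp add: symmetry_dot[OF n3 g])
  \<comment> \<open>Cut entries are \<open>0\<close> or \<open>1\<close>, so squares are dropped and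
    the sum is taken row by row.\<close>
  also have "\<dots> = (\<Sum>k=1..n. \<Sum>l=1..n. entry (cut_vector n {i, j}) k l)"
    unfolding dot_pairs by (intro sum.cong) (auto simp: entry_cut)
  also have "\<dots> = (\<Sum>k=1..n. dot (pairs n) (cut_vector n {i, j}) (cut_vector n {k}))"
    by (intro sum.cong) (simp_all add: dot_cut_singleton)
  also have "\<dots> = (\<Sum>k=1..n. (if k = i then real n - 4 else 0) + (if k = j then real n - 4 else 0) + 2)"
    using ij by (intro sum.cong refl) (auto simp: dot_cuts)
  also have "\<dots> = 4 * (real n - 2)"
    using ij by (simp add: sum.distrib)
  finally have sq: "(\<Sum>k=1..n. \<Sum>l=1..n. (entry ?x k l)\<^sup>2) = 4 * (real (card {1..n}) - 2)"
    by simp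
  have \<sigma>: "\<sigma> i \<in> {1..n}" "\<sigma> j \<in> {1..n}" "\<sigma> i \<noteq> \<sigma> j"
    using ij permutes_in_image[OF perm] permutes_inj[OF perm] by (auto simp: inj_eq)
  fix k l assume kl: "k \<in> {1..n}" "l \<in> {1..n}"
  show "entry ?x k l = entry (cut_vector n {\<sigma> i, \<sigma> j}) k l"
    unfolding entry_cut[OF kl] using n by (intro eq_two_point_cut \<sigma> rowi row2 sq kl) simp_all
qed (use n g in \<open>simp_all add: symmetry_coord\<close>)

section \<open>Symmetries induced by permutations of the points\<close>

text \<open>The inverse makes this a left action, so that it is multiplicative in
  \<open>\<sigma>\<close> and moves a cut to the cut of the image set.\<close>

definition permute_coords :: "nat \<Rightarrow> (nat \<Rightarrow> nat) \<Rightarrow> (nat \<times> nat \<Rightarrow> real) \<Rightarrow> nat \<times> nat \<Rightarrow> real" where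
  "permute_coords n \<sigma> = (\<lambda>x\<in>coord_space (pairs n). of_entries n (\<lambda>i j. entry x (inv' \<sigma> i) (inv' \<sigma> j)))"

lemma entry_permute_coords:
  "\<lbrakk>x \<in> coord_space (pairs n); i \<in> {1..n}; j \<in> {1..n}\<rbrakk>
    \<Longrightarrow> entry (permute_coords n \<sigma> x) i j = entry x (inv' \<sigma> i) (inv' \<sigma> j)"
  using entry_of_entries[of "\<lambda>i j. entry x (inv' \<sigma> i) (inv' \<sigma> j)" i n j]
  by (simp add: permute_coords_def entry_sym)

lemma permute_coords_coord:
  "x \<in> coord_space (pairs n) \<Longrightarrow> permute_coords n \<sigma> x \<in> coord_space (pairs n)"
  by (simp add: permute_coords_def)

lemma permute_coords_linear: "permute_coords n \<sigma> \<in> linear_transformations (pairs n)"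
  by (auto simp: linear_transformations_def permute_coords_def coord_space_def fun_eq_iff
      of_entries_def entry_def)

lemma permute_coords_id:
  assumes x: "x \<in> coord_space (pairs n)"
  shows "permute_coords n id x = x"
proof (rule coord_eqI)
  fix i j assume "i \<in> {1..n}" "j \<in> {1..n}"
  then show "entry (permute_coords n id x) i j = entry x i j"
    using entry_permute_coords[OF x, of i j id] by simp
qed (use x in \<open>simp_all add: permute_coords_coord\<close>)

lemma permute_coords_comp:
  assumes "\<sigma> permutes {1..n}" "\<tau> permutes {1..n}" "x \<in> coord_space (pairs n)"
  shows "permute_coords n (\<sigma> \<circ> \<tau>) x = permute_coords n \<sigma> (permute_coords n \<tau> x)"
proof (rule coord_eqI)
  fix i j assume "i \<in> {1..n}" "j \<in> {1..n}"
  moreover from this have "inv' \<sigma> i \<in> {1..n}" "inv' \<sigma> j \<in> {1..n}"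
    using permutes_in_image[OF permutes_inv[OF assms(1)]] by auto
  ultimately show "entry (permute_coords n (\<sigma> \<circ> \<tau>) x) i j
      = entry (permute_coords n \<sigma> (permute_coords n \<tau> x)) i j"
    using assms
    by (simp add: entry_permute_coords permute_coords_coord o_inv_distrib permutes_bij)
qed (use assms in \<open>simp_all add: permute_coords_coord\<close>)

lemma sum_sum_permute:
  assumes "\<sigma> permutes S"
  shows "(\<Sum>i\<in>S. \<Sum>j\<in>S. f (inv' \<sigma> i) (inv' \<sigma> j)) = (\<Sum>i\<in>S. \<Sum>j\<in>S. f i j)"
proof -
  have inner: "(\<Sum>j\<in>S. h (inv' \<sigma> j)) = (\<Sum>j\<in>S. h j)" for h :: "'a \<Rightarrow> 'b"
    using sum.permute[OF permutes_inv[OF assms], of h] by (simp add: comp_def)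
  show ?thesis
    using inner[of "\<lambda>i. \<Sum>j\<in>S. f i j"] by (simp add: inner[of "f _"])
qed

text \<open>The form of the permuted vector at \<open>b\<close> is the form of \<open>x\<close> at
  \<open>b \<circ> \<sigma>\<close>, which still sums to \<open>1\<close>.\<close>

lemma permute_coords_hypermetric:
  assumes perm: "\<sigma> permutes {1..n}" and x: "x \<in> hypermetric_cone n"
  shows "permute_coords n \<sigma> x \<in> hypermetric_cone n"
proof -
  have xc: "x \<in> coord_space (pairs n)"
    by (rule hypermetric_cone_coord[OF x])
  have "(\<Sum>i=1..n. \<Sum>j=1..n. real_of_int (b i * b j) * entry (permute_coords n \<sigma> x) i j) \<le> 0"
    if b: "(\<Sum>i=1..n. b i) = (1 :: int)" for b
  proof -
    have "(\<Sum>i=1..n. b (\<sigma> i)) = 1"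
      using b sum.permute[OF perm, of b] by (simp add: comp_def)
    then have "(\<Sum>i=1..n. \<Sum>j=1..n. real_of_int (b (\<sigma> i) * b (\<sigma> j)) * entry x i j) \<le> 0"
      using x unfolding hypermetric_cone_iff by blast
    also have "(\<Sum>i=1..n. \<Sum>j=1..n. real_of_int (b (\<sigma> i) * b (\<sigma> j)) * entry x i j)
      = (\<Sum>i=1..n. \<Sum>j=1..n. real_of_int (b i * b j) * entry (permute_coords n \<sigma> x) i j)"
      unfolding sum_sum_permute[OF perm, symmetric, of "\<lambda>i j. real_of_int (b (\<sigma> i) * b (\<sigma> j)) * entry x i j"]
      by (intro sum.cong) (simp_all add: entry_permute_coords[OF xc] permutes_inverses[OF perm])
    finally show ?thesis .
  qed
  then show ?thesis
    by (simp add: hypermetric_cone_iff permute_coords_coord[OF xc])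
qed

lemma permute_coords_symmetry:
  assumes perm: "\<sigma> permutes {1..n}"
  shows "permute_coords n \<sigma> \<in> carrier (symmetry_group (pairs n) (hypermetric_cone n))"
proof (rule symmetry_groupI[OF permute_coords_linear])
  fix x :: "nat \<times> nat \<Rightarrow> real" assume x: "x \<in> coord_space (pairs n)"
  have "2 * dot (pairs n) (permute_coords n \<sigma> x) (permute_coords n \<sigma> x)
      = (\<Sum>i=1..n. \<Sum>j=1..n. entry x (inv' \<sigma> i) (inv' \<sigma> j) * entry x (inv' \<sigma> i) (inv' \<sigma> j))"
    unfolding dot_pairs by (intro sum.cong) (simp_all add: entry_permute_coords[OF x])
  also have "\<dots> = 2 * dot (pairs n) x x"
    unfolding dot_pairs by (rule sum_sum_permute[OF perm])
  finally show "dot (pairs n) (permute_coords n \<sigma> x) (permute_coords n \<sigma> x) = dot (pairs n) x x"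
    by simp
next
  show "permute_coords n \<sigma> ` hypermetric_cone n = hypermetric_cone n"
  proof
    show "permute_coords n \<sigma> ` hypermetric_cone n \<subseteq> hypermetric_cone n"
      using permute_coords_hypermetric[OF perm] by blast
    show "hypermetric_cone n \<subseteq> permute_coords n \<sigma> ` hypermetric_cone n"
    proof
      fix x assume x: "x \<in> hypermetric_cone n"
      have "x = permute_coords n \<sigma> (permute_coords n (inv' \<sigma>) x)"
        using permute_coords_comp[OF perm permutes_inv[OF perm] hypermetric_cone_coord[OF x]]
          permute_coords_id[OF hypermetric_cone_coord[OF x]] permutes_inv_o[OF perm] by simp
      then show "x \<in> permute_coords n \<sigma> ` hypermetric_cone n"
        using permute_coords_hypermetric[OF permutes_inv[OF perm] x] by blast
    qed
  qed
qed

lemma permute_coords_cut: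
  assumes perm: "\<sigma> permutes {1..n}"
  shows "permute_coords n \<sigma> (cut_vector n A) = cut_vector n (\<sigma> ` A)"
proof (rule coord_eqI)
  fix i j assume ij: "i \<in> {1..n}" "j \<in> {1..n}"
  have "inv' \<sigma> k \<in> A \<longleftrightarrow> k \<in> \<sigma> ` A" for k
    by (metis image_iff permutes_inverses[OF perm])
  then show "entry (permute_coords n \<sigma> (cut_vector n A)) i j = entry (cut_vector n (\<sigma> ` A)) i j"
    using ij permutes_in_image[OF permutes_inv[OF perm]]
    by (simp add: entry_permute_coords entry_cut)
qed (simp_all add: permute_coords_coord)

theorem symmetry_group_hypermetric_cone:
  assumes n: "n \<ge> 5"
  shows "symmetry_group (pairs n) (hypermetric_cone n) \<cong> sym_group n"
proof -
  let ?G = "symmetry_group (pairs n) (hypermetric_cone n)"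
  have n3: "n \<ge> 3" using n by simp
  have "permute_coords n \<in> iso (sym_group n) ?G"
  proof (rule isoI)
    show "permute_coords n \<in> hom (sym_group n) ?G"
    proof (rule homI)
      fix \<sigma> \<tau> assume "\<sigma> \<in> carrier (sym_group n)" "\<tau> \<in> carrier (sym_group n)"
      then have "\<sigma> permutes {1..n}" "\<tau> permutes {1..n}"
        by (simp_all add: sym_group_carrier)
      \<comment> \<open>On \<open>coord_space (pairs n)\<close> this is
        \<open>permute_coords_comp\<close>. Elsewhere both representatives are
        \<open>undefined\<close>, which the second \<open>auto\<close> settles.\<close>
      then show "permute_coords n (\<sigma> \<otimes>\<^bsub>sym_group n\<^esub> \<tau>)
          = permute_coords n \<sigma> \<otimes>\<^bsub>?G\<^esub> permute_coords n \<tau>"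
        using permute_coords_comp[of \<sigma> n \<tau>]
        by (auto simp: sym_group_mult mult_symmetry_group compose_def fun_eq_iff)
          (auto simp: permute_coords_def)
    qed (simp add: sym_group_carrier permute_coords_symmetry)
    show "bij_betw (permute_coords n) (carrier (sym_group n)) (carrier ?G)"
    proof (intro bij_betw_imageI inj_onI equalityI subsetI)
      fix \<sigma> \<tau> assume "\<sigma> \<in> carrier (sym_group n)" "\<tau> \<in> carrier (sym_group n)"
        and eq: "permute_coords n \<sigma> = permute_coords n \<tau>"
      then have perms: "\<sigma> permutes {1..n}" "\<tau> permutes {1..n}"
        by (simp_all add: sym_group_carrier)
      show "\<sigma> = \<tau>"
      proof
        fix i
        show "\<sigma> i = \<tau> i"
        proof (cases "i \<in> {1..n}")
          case True
          then have "\<sigma> i \<in> {1..n}" "\<tau> i \<in> {1..n}"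
            using permutes_in_image perms by metis+
          moreover have "cut_vector n {\<sigma> i} = cut_vector n {\<tau> i}"
            using permute_coords_cut[OF perms(1), of "{i}"] permute_coords_cut[OF perms(2), of "{i}"] eq
            by simp
          ultimately show ?thesis
            by (rule cut_singleton_inject[OF n3])
        next
          case False
          then show ?thesis
            using perms by (simp add: permutes_not_in)
        qed
      qed
    next
      fix g assume g: "g \<in> carrier ?G"
      obtain \<sigma> where perm: "\<sigma> permutes {1..n}"
        and single: "\<And>i. i \<in> {1..n} \<Longrightarrow> g (cut_vector n {i}) = cut_vector n {\<sigma> i}"
        using symmetry_permutes_cuts[OF n3 g] by blast
      \<comment> \<open>The maps agree on one-point cuts by the choice of \<open>\<sigma>\<close>
        and on two-point cuts by \<open>symmetry_cut_pair\<close>, and these cuts span.\<close>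
      have "g = permute_coords n \<sigma>"
        using symmetry_cut_pair[OF n g perm single] single
        by (intro linear_eqI_cuts[OF symmetry_groupD(1)[OF g] permute_coords_linear])
          (simp_all add: permute_coords_cut[OF perm])
      then show "g \<in> permute_coords n ` carrier (sym_group n)"
        using perm by (simp add: sym_group_carrier)
    qed (auto simp: sym_group_carrier permute_coords_symmetry)
  qed
  then show ?thesis
    by (rule group.iso_sym[OF sym_group_is_group is_isoI])
qed

section \<open>Symmetries of the cone for \<open>n = 4\<close>\<close>

definition row_sum :: "(nat \<times> nat \<Rightarrow> real) \<Rightarrow> nat \<Rightarrow> real" where
  "row_sum x i = (\<Sum>j=1..4. entry x i j)"

text \<open>Matching \<open>k\<close> is the perfect matching of four points that contains
  \<open>{1, k + 1}\<close>; indices other than \<open>1\<close> and \<open>2\<close> default to the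
  third. \<open>matching\<close> below uses the same numbering.\<close>

definition matching_sum :: "(nat \<times> nat \<Rightarrow> real) \<Rightarrow> nat \<Rightarrow> real" where
  "matching_sum x k = (if k = 1 then x (1, 2) + x (3, 4)
     else if k = 2 then x (1, 3) + x (2, 4) else x (1, 4) + x (2, 3))"

definition matching :: "nat \<Rightarrow> nat \<Rightarrow> nat" where
  "matching i j = (if {i, j} = {1, 2} \<or> {i, j} = {3, 4} then 1
     else if {i, j} = {1, 3} \<or> {i, j} = {2, 4} then 2 else 3)"

text \<open>This inverts the passage to sums: \<open>r i + r j\<close> counts the pair
  \<open>{i, j}\<close> twice and every pair of the other two matchings once. Adding the matching of
  \<open>{i, j}\<close> and subtracting all three leaves twice the coordinate.\<close>

definition of_sums :: "(nat \<Rightarrow> real) \<Rightarrow> (nat \<Rightarrow> real) \<Rightarrow> nat \<times> nat \<Rightarrow> real" where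
  "of_sums q r = of_entries 4 (\<lambda>i j. (q (matching i j) + r i + r j - (q 1 + q 2 + q 3)) / 2)"

lemma sum_1_4: "(\<Sum>i=1..4. f i) = f 1 + f 2 + f 3 + (f 4 :: real)" for f :: "nat \<Rightarrow> real"
  by (simp add: eval_nat_numeral)

lemma sum_1_3: "(\<Sum>i=1..3. f i) = f 1 + f 2 + (f 3 :: real)" for f :: "nat \<Rightarrow> real"
  by (simp add: eval_nat_numeral)

lemma interval_1_4: "{1..4} = {1, 2, 3, 4 :: nat}"
  by auto

lemma interval_1_3: "{1..3} = {1, 2, 3 :: nat}"
  by auto

lemma pairs_4: "pairs 4 = {(1, 2), (1, 3), (1, 4), (2, 3), (2, 4), (3, 4)}"
proof -
  have "p \<in> pairs 4 \<longleftrightarrow> p \<in> {(1, 2), (1, 3), (1, 4), (2, 3), (2, 4), (3, 4)}" for p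
  proof (cases p)
    case (Pair i j)
    then show ?thesis by (simp add: pairs_def del: One_nat_def) presburger
  qed
  then show ?thesis by blast
qed

lemma row_sum_simps:
  "row_sum x 1 = x (1, 2) + x (1, 3) + x (1, 4)"
  "row_sum x 2 = x (1, 2) + x (2, 3) + x (2, 4)"
  "row_sum x 3 = x (1, 3) + x (2, 3) + x (3, 4)"
  "row_sum x 4 = x (1, 4) + x (2, 4) + x (3, 4)"
  unfolding row_sum_def sum_1_4 by (simp_all add: entry_def)

lemma matching_sum_simps:
  "matching_sum x 1 = x (1, 2) + x (3, 4)"
  "matching_sum x 2 = x (1, 3) + x (2, 4)"
  "matching_sum x 3 = x (1, 4) + x (2, 3)"
  by (simp_all add: matching_sum_def)

lemma of_sums_simps:
  "of_sums q r (1, 2) = (q 1 + r 1 + r 2 - (q 1 + q 2 + q 3)) / 2"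
  "of_sums q r (3, 4) = (q 1 + r 3 + r 4 - (q 1 + q 2 + q 3)) / 2"
  "of_sums q r (1, 3) = (q 2 + r 1 + r 3 - (q 1 + q 2 + q 3)) / 2"
  "of_sums q r (2, 4) = (q 2 + r 2 + r 4 - (q 1 + q 2 + q 3)) / 2"
  "of_sums q r (1, 4) = (q 3 + r 1 + r 4 - (q 1 + q 2 + q 3)) / 2"
  "of_sums q r (2, 3) = (q 3 + r 2 + r 3 - (q 1 + q 2 + q 3)) / 2"
  by (simp_all add: of_sums_def of_entries_def pairs_def matching_def doubleton_eq_iff)

lemma of_sums_coord [simp]: "of_sums q r \<in> coord_space (pairs 4)"
  by (simp add: of_sums_def)

lemma coord_4_eqI:
  assumes "x \<in> coord_space (pairs 4)" "y \<in> coord_space (pairs 4)"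
    and "x (1, 2) = y (1, 2)" "x (1, 3) = y (1, 3)" "x (1, 4) = y (1, 4)"
    and "x (2, 3) = y (2, 3)" "x (2, 4) = y (2, 4)" "x (3, 4) = y (3, 4)"
  shows "x = y"
proof
  fix p :: "nat \<times> nat"
  show "x p = y p"
  proof (cases "p \<in> pairs 4")
    case True
    then show ?thesis
      using assms(3-) unfolding pairs_4 by blast
  next
    case False
    then show ?thesis
      using assms(1,2) by (cases p) (simp add: coord_space_def)
  qed
qed

lemma of_sums_sums:
  "x \<in> coord_space (pairs 4) \<Longrightarrow> of_sums (matching_sum x) (row_sum x) = x"
  by (rule coord_4_eqI; (simp only: of_sums_simps row_sum_simps matching_sum_simps)?) simp_all

lemma sums_eqI:
  assumes "x \<in> coord_space (pairs 4)" "y \<in> coord_space (pairs 4)"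
    and "\<And>k. k \<in> {1..3} \<Longrightarrow> matching_sum x k = matching_sum y k"
    and "\<And>i. i \<in> {1..4} \<Longrightarrow> row_sum x i = row_sum y i"
  shows "x = y"
proof -
  have "of_sums (matching_sum x) (row_sum x) = of_sums (matching_sum y) (row_sum y)"
    using assms(3)[of 1] assms(3)[of 2] assms(3)[of 3]
      assms(4)[of 1] assms(4)[of 2] assms(4)[of 3] assms(4)[of 4]
    by (intro coord_4_eqI) (simp_all only: of_sums_coord of_sums_simps interval_1_3 interval_1_4 insert_iff simp_thms)
  then show ?thesis
    using assms(1,2) by (simp add: of_sums_sums)
qed

lemma sum_row_sum: "(\<Sum>i=1..4. row_sum x i) = 2 * (\<Sum>k=1..3. matching_sum x k)"
  unfolding sum_1_4 sum_1_3 row_sum_simps matching_sum_simps by simp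

text \<open>Seven sums describe six coordinates. Every pair lies in two rows and one matching, and
  the resulting relation is the only constraint on the sums.\<close>

lemma sums_of_sums:
  assumes "(\<Sum>i=1..4. r i) = 2 * (\<Sum>k=1..3. q k)"
  shows "k \<in> {1..3} \<Longrightarrow> matching_sum (of_sums q r) k = q k"
    and "i \<in> {1..4} \<Longrightarrow> row_sum (of_sums q r) i = r i"
proof -
  have eq: "r 1 + r 2 + r 3 + r 4 = 2 * (q 1 + q 2 + q 3)"
    using assms unfolding sum_1_4 sum_1_3 .
  show "k \<in> {1..3} \<Longrightarrow> matching_sum (of_sums q r) k = q k"
    unfolding interval_1_3 using eq
    by (elim insertE emptyE; simp only: matching_sum_simps of_sums_simps; argo)
  show "i \<in> {1..4} \<Longrightarrow> row_sum (of_sums q r) i = r i"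
    unfolding interval_1_4 using eq
    by (elim insertE emptyE; simp only: row_sum_simps of_sums_simps; argo)
qed

text \<open>Products of disjoint pairs come from squared matching sums, and products of pairs
  sharing a point from squared row sums; the square of the total removes both. The result is
  symmetric in each family separately, so permuting either family is an isometry.\<close>

lemma dot_4:
  "2 * dot (pairs 4) x x
    = (\<Sum>k=1..3. (matching_sum x k)\<^sup>2) + (\<Sum>i=1..4. (row_sum x i)\<^sup>2) - (\<Sum>k=1..3. matching_sum x k)\<^sup>2"
  unfolding sum_1_4 sum_1_3 row_sum_simps matching_sum_simps dot_def pairs_4
  by (simp add: power2_eq_square algebra_simps del: One_nat_def)

section \<open>The cone on four points in terms of row sums and matching sums\<close>

lemma hypermetric_cone_conic:
  assumes "x \<in> hypermetric_cone n" "y \<in> hypermetric_cone n" "0 \<le> c" "0 \<le> d"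
  shows "(\<lambda>p. c * x p + d * y p) \<in> hypermetric_cone n"
proof -
  have "(\<Sum>(i, j)\<in>pairs n. real_of_int (b i * b j) * (c * x (i, j) + d * y (i, j)))
      = c * (\<Sum>(i, j)\<in>pairs n. real_of_int (b i * b j) * x (i, j))
        + d * (\<Sum>(i, j)\<in>pairs n. real_of_int (b i * b j) * y (i, j))" for b :: "nat \<Rightarrow> int"
    unfolding sum_distrib_left sum.distrib[symmetric] by (intro sum.cong) (auto simp: algebra_simps)
  then show ?thesis
    using assms by (simp add: hypermetric_cone_def add_nonpos_nonpos mult_nonneg_nonpos)
qed

lemma hypermetric_cone_sum:
  assumes "finite A" "\<And>a. a \<in> A \<Longrightarrow> 0 \<le> c a" "\<And>a. a \<in> A \<Longrightarrow> v a \<in> hypermetric_cone n"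
  shows "(\<lambda>p. \<Sum>a\<in>A. c a * v a p) \<in> hypermetric_cone n"
  using assms
proof (induction A rule: finite_induct)
  case empty
  then show ?case by (simp add: hypermetric_cone_def case_prod_unfold)
next
  case (insert a A)
  then show ?case
    using hypermetric_cone_conic[of "v a" n "\<lambda>p. \<Sum>a\<in>A. c a * v a p" "c a" 1] by simp
qed

text \<open>\<open>row_sum x i - matching_sum x k\<close> is the defect of the triangle inequality
  through \<open>i\<close> for the pair of matching \<open>k\<close> avoiding \<open>i\<close>, and
  all twelve triangle inequalities arise so. Conversely, they suffice to write \<open>x\<close> as a
  nonnegative combination of cuts.\<close>

lemma hypermetric_cone_4_iff:
  assumes x: "x \<in> coord_space (pairs 4)"
  shows "x \<in> hypermetric_cone 4 \<longleftrightarrow> (\<forall>k\<in>{1..3}. \<forall>i\<in>{1..4}. matching_sum x k \<le> row_sum x i)"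
proof
  assume "x \<in> hypermetric_cone 4"
  then have tri: "entry x i j \<le> entry x i k + entry x k j"
    if "{i, j, k} \<subseteq> {1..4}" "distinct [i, j, k]" for i j k
    using that by (intro hypermetric_cone_triangle)
  show "\<forall>k\<in>{1..3}. \<forall>i\<in>{1..4}. matching_sum x k \<le> row_sum x i"
    unfolding interval_1_3 interval_1_4 ball_simps row_sum_simps matching_sum_simps
    using tri[of 3 4 1] tri[of 3 4 2] tri[of 1 2 3] tri[of 1 2 4]
      tri[of 2 4 1] tri[of 1 3 2] tri[of 2 4 3] tri[of 1 3 4]
      tri[of 2 3 1] tri[of 1 4 2] tri[of 1 4 3] tri[of 2 3 4]
    by (simp add: entry_def)
next
  assume le: "\<forall>k\<in>{1..3}. \<forall>i\<in>{1..4}. matching_sum x k \<le> row_sum x i"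
  \<comment> \<open>With \<open>m = Min r\<^sub>i\<close>, \<open>x\<close> is the cut combination \<open>\<Sum> (r\<^sub>i - m)/2 \<delta>({i}) + \<Sum> (m - q\<^sub>k)/2 \<delta>({1, k + 1})\<close>.\<close>
  define m where "m = Min (row_sum x ` {1..4})"
  have m_le: "m \<le> row_sum x i" if "i \<in> {1..4}" for i
    using that by (simp add: m_def)
  have "m \<in> row_sum x ` {1..4}"
    unfolding m_def by (intro Min_in) auto
  then have m_ge: "matching_sum x k \<le> m" if "k \<in> {1..3}" for k
    using le that by auto
  let ?y = "\<lambda>p. \<Sum>i=1..4. (row_sum x i - m) / 2 * cut_vector 4 {i} p"
  let ?z = "\<lambda>p. \<Sum>k=1..3. (m - matching_sum x k) / 2 * cut_vector 4 {1, Suc k} p"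
  have y: "?y \<in> hypermetric_cone 4" and z: "?z \<in> hypermetric_cone 4"
    by (rule hypermetric_cone_sum; use m_le m_ge in \<open>simp add: cut_hypermetric\<close>)+
  have "x = (\<lambda>p. ?y p + ?z p)"
    by (rule coord_4_eqI[OF x]; (intro coord_space_closed(2) hypermetric_cone_coord y z)?;
        (simp add: sum_1_4 sum_1_3 row_sum_simps matching_sum_simps cut_vector_def of_entries_def pairs_def
          field_simps del: One_nat_def)?)
  then show "x \<in> hypermetric_cone 4"
    using hypermetric_cone_conic[OF y z, of 1 1] by simp
qed

lemma sums_linear:
  "row_sum (\<lambda>p. x p + y p) i = row_sum x i + row_sum y i"
  "row_sum (\<lambda>p. c * x p) i = c * row_sum x i"
  "matching_sum (\<lambda>p. x p + y p) k = matching_sum x k + matching_sum y k"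
  "matching_sum (\<lambda>p. c * x p) k = c * matching_sum x k"
proof -
  have "entry (\<lambda>p. x p + y p) i j = entry x i j + entry y i j"
    "entry (\<lambda>p. c * x p) i j = c * entry x i j" for j
    by (auto simp: entry_def)
  then show "row_sum (\<lambda>p. x p + y p) i = row_sum x i + row_sum y i"
    "row_sum (\<lambda>p. c * x p) i = c * row_sum x i"
    by (simp_all add: row_sum_def sum.distrib sum_distrib_left)
qed (simp_all add: matching_sum_def distrib_left)

section \<open>Row sums and matching sums of the cuts on four points\<close>

lemma cut_4_simps:
  "cut_vector 4 A (1, 2) = of_bool ((1 \<in> A) \<noteq> (2 \<in> A))"
  "cut_vector 4 A (1, 3) = of_bool ((1 \<in> A) \<noteq> (3 \<in> A))"
  "cut_vector 4 A (1, 4) = of_bool ((1 \<in> A) \<noteq> (4 \<in> A))"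
  "cut_vector 4 A (2, 3) = of_bool ((2 \<in> A) \<noteq> (3 \<in> A))"
  "cut_vector 4 A (2, 4) = of_bool ((2 \<in> A) \<noteq> (4 \<in> A))"
  "cut_vector 4 A (3, 4) = of_bool ((3 \<in> A) \<noteq> (4 \<in> A))"
  by (simp_all add: cut_vector_def of_entries_def pairs_def)

lemma cut_singleton_sums:
  assumes "i \<in> {1..4}"
  shows "k \<in> {1..3} \<Longrightarrow> matching_sum (cut_vector 4 {i}) k = 1"
    and "j \<in> {1..4} \<Longrightarrow> row_sum (cut_vector 4 {i}) j = (if j = i then 3 else 1)"
  using assms unfolding interval_1_4 interval_1_3
  by (elim insertE emptyE; simp add: matching_sum_simps row_sum_simps cut_4_simps del: One_nat_def)+

text \<open>The cut by \<open>{1, l + 1}\<close> separates all pairs except the two of matching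
  \<open>l\<close>. Its row sums are constant and only its matching sums depend on \<open>l\<close>,
  the reverse of the one-point cuts.\<close>

lemma cut_pair_sums:
  assumes "l \<in> {1..3}"
  shows "k \<in> {1..3} \<Longrightarrow> matching_sum (cut_vector 4 {1, Suc l}) k = (if k = l then 0 else 2)"
    and "j \<in> {1..4} \<Longrightarrow> row_sum (cut_vector 4 {1, Suc l}) j = 2"
  using assms unfolding interval_1_4 interval_1_3
  by (elim insertE emptyE; simp add: matching_sum_simps row_sum_simps cut_4_simps del: One_nat_def)+

lemma cut_pair_inject:
  assumes "k \<in> {1..3}" "l \<in> {1..3}" "cut_vector 4 {1, Suc k} = cut_vector 4 {1, Suc l}"
  shows "k = l"
proof (rule ccontr)
  assume "k \<noteq> l"
  then show False
    using cut_pair_sums(1)[OF assms(1,1)] cut_pair_sums(1)[OF assms(2,1)] unfolding assms(3) by simp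
qed

text \<open>A two-point set and its complement give the same cut, so there are three such cuts, each
  represented by a set containing \<open>1\<close>.\<close>

lemma cut_pair_cases:
  assumes "i \<in> {1..4}" "j \<in> {1..4}" "i < j"
  obtains k where "k \<in> {1..3}" "cut_vector 4 {i, j} = cut_vector 4 {1, Suc k}"
proof
  show "matching i j \<in> {1..3}"
    by (simp add: matching_def)
  show "cut_vector 4 {i, j} = cut_vector 4 {1, Suc (matching i j)}"
    using assms unfolding interval_1_4
    by (intro coord_4_eqI cut_coord; elim insertE emptyE;
        simp add: matching_def doubleton_eq_iff cut_4_simps del: One_nat_def)
qed

section \<open>Independent permutations of matching sums and row sums\<close>

definition permute_sums :: "(nat \<Rightarrow> nat) \<Rightarrow> (nat \<Rightarrow> nat) \<Rightarrow> (nat \<times> nat \<Rightarrow> real) \<Rightarrow> nat \<times> nat \<Rightarrow> real" where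
  "permute_sums \<tau> \<sigma> = (\<lambda>x\<in>coord_space (pairs 4).
     of_sums (\<lambda>k. matching_sum x (inv' \<tau> k)) (\<lambda>i. row_sum x (inv' \<sigma> i)))"

lemma permute_sums_coord:
  "x \<in> coord_space (pairs 4) \<Longrightarrow> permute_sums \<tau> \<sigma> x \<in> coord_space (pairs 4)"
  by (simp add: permute_sums_def)

lemma sum_inv_permute:
  assumes "\<sigma> permutes S"
  shows "(\<Sum>i\<in>S. f (inv' \<sigma> i)) = (\<Sum>i\<in>S. f i)"
  using sum.permute[OF permutes_inv[OF assms], of f] by (simp add: comp_def)

context
  fixes \<tau> \<sigma> :: "nat \<Rightarrow> nat"
  assumes perms: "\<tau> permutes {1..3}" "\<sigma> permutes {1..4}"
begin

text \<open>Permuting leaves both totals unchanged, so the relation required by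
  \<open>sums_of_sums\<close> survives.\<close>

lemma sums_permute_sums:
  assumes x: "x \<in> coord_space (pairs 4)"
  shows "k \<in> {1..3} \<Longrightarrow> matching_sum (permute_sums \<tau> \<sigma> x) k = matching_sum x (inv' \<tau> k)"
    and "i \<in> {1..4} \<Longrightarrow> row_sum (permute_sums \<tau> \<sigma> x) i = row_sum x (inv' \<sigma> i)"
proof -
  have eq: "(\<Sum>i=1..4. row_sum x (inv' \<sigma> i)) = 2 * (\<Sum>k=1..3. matching_sum x (inv' \<tau> k))"
    unfolding sum_inv_permute[OF perms(1)] sum_inv_permute[OF perms(2)] by (rule sum_row_sum)
  show "k \<in> {1..3} \<Longrightarrow> matching_sum (permute_sums \<tau> \<sigma> x) k = matching_sum x (inv' \<tau> k)"
    "i \<in> {1..4} \<Longrightarrow> row_sum (permute_sums \<tau> \<sigma> x) i = row_sum x (inv' \<sigma> i)"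
    using x sums_of_sums[OF eq] by (simp_all add: permute_sums_def)
qed

lemma permute_sums_linear: "permute_sums \<tau> \<sigma> \<in> linear_transformations (pairs 4)"
proof -
  have "permute_sums \<tau> \<sigma> (\<lambda>p. x p + y p) = (\<lambda>p. permute_sums \<tau> \<sigma> x p + permute_sums \<tau> \<sigma> y p)"
    if "x \<in> coord_space (pairs 4)" "y \<in> coord_space (pairs 4)" for x y
    using that by (intro sums_eqI) (simp_all only: sums_permute_sums sums_linear permute_sums_coord coord_space_closed)
  moreover have "permute_sums \<tau> \<sigma> (\<lambda>p. c * x p) = (\<lambda>p. c * permute_sums \<tau> \<sigma> x p)"
    if "x \<in> coord_space (pairs 4)" for c x
    using that by (intro sums_eqI) (simp_all only: sums_permute_sums sums_linear permute_sums_coord coord_space_closed)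
  moreover have "permute_sums \<tau> \<sigma> \<in> coord_space (pairs 4) \<rightarrow>\<^sub>E coord_space (pairs 4)"
    by (simp add: permute_sums_def)
  ultimately show ?thesis
    by (simp add: linear_transformations_def)
qed

lemma permute_sums_hypermetric:
  assumes x: "x \<in> hypermetric_cone 4"
  shows "permute_sums \<tau> \<sigma> x \<in> hypermetric_cone 4"
proof -
  note xc = hypermetric_cone_coord[OF x]
  have "inv' \<tau> k \<in> {1..3}" if "k \<in> {1..3}" for k
    using that permutes_in_image[OF permutes_inv[OF perms(1)]] by blast
  moreover have "inv' \<sigma> i \<in> {1..4}" if "i \<in> {1..4}" for i
    using that permutes_in_image[OF permutes_inv[OF perms(2)]] by blast
  ultimately show ?thesis
    using x unfolding hypermetric_cone_4_iff[OF xc] hypermetric_cone_4_iff[OF permute_sums_coord[OF xc]]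
    by (simp add: sums_permute_sums[OF xc] del: atLeastAtMost_iff)
qed

text \<open>All matching sums of \<open>\<delta>({i})\<close> are \<open>1\<close>, so
  \<open>\<tau>\<close> acts trivially here. Likewise \<open>\<sigma>\<close> acts trivially on the
  two-point cuts, whose row sums are all \<open>2\<close>.\<close>

lemma permute_sums_cut_singleton:
  assumes i: "i \<in> {1..4}"
  shows "permute_sums \<tau> \<sigma> (cut_vector 4 {i}) = cut_vector 4 {\<sigma> i}"
proof (intro sums_eqI permute_sums_coord cut_coord)
  have \<sigma>i: "\<sigma> i \<in> {1..4}"
    using i permutes_in_image[OF perms(2)] by blast
  fix k :: nat assume k: "k \<in> {1..3}"
  then have "inv' \<tau> k \<in> {1..3}"
    using permutes_in_image[OF permutes_inv[OF perms(1)]] by blast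
  then show "matching_sum (permute_sums \<tau> \<sigma> (cut_vector 4 {i})) k = matching_sum (cut_vector 4 {\<sigma> i}) k"
    by (simp only: sums_permute_sums(1)[OF cut_coord k] cut_singleton_sums(1)[OF i] cut_singleton_sums(1)[OF \<sigma>i k])
next
  have \<sigma>i: "\<sigma> i \<in> {1..4}"
    using i permutes_in_image[OF perms(2)] by blast
  fix j :: nat assume j: "j \<in> {1..4}"
  then have "inv' \<sigma> j \<in> {1..4}"
    using permutes_in_image[OF permutes_inv[OF perms(2)]] by blast
  moreover have "inv' \<sigma> j = i \<longleftrightarrow> j = \<sigma> i"
    using permutes_inv_eq[OF perms(2), of j i] by auto
  ultimately show "row_sum (permute_sums \<tau> \<sigma> (cut_vector 4 {i})) j = row_sum (cut_vector 4 {\<sigma> i}) j"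
    by (simp only: sums_permute_sums(2)[OF cut_coord j] cut_singleton_sums(2)[OF i] cut_singleton_sums(2)[OF \<sigma>i j])
qed

lemma permute_sums_cut_pair:
  assumes l: "l \<in> {1..3}"
  shows "permute_sums \<tau> \<sigma> (cut_vector 4 {1, Suc l}) = cut_vector 4 {1, Suc (\<tau> l)}"
proof (intro sums_eqI permute_sums_coord cut_coord)
  have \<tau>l: "\<tau> l \<in> {1..3}"
    using l permutes_in_image[OF perms(1)] by blast
  fix k :: nat assume k: "k \<in> {1..3}"
  then have "inv' \<tau> k \<in> {1..3}"
    using permutes_in_image[OF permutes_inv[OF perms(1)]] by blast
  moreover have "inv' \<tau> k = l \<longleftrightarrow> k = \<tau> l"
    using permutes_inv_eq[OF perms(1), of k l] by auto
  ultimately show "matching_sum (permute_sums \<tau> \<sigma> (cut_vector 4 {1, Suc l})) k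
      = matching_sum (cut_vector 4 {1, Suc (\<tau> l)}) k"
    by (simp only: sums_permute_sums(1)[OF cut_coord k] cut_pair_sums(1)[OF l] cut_pair_sums(1)[OF \<tau>l k])
next
  have \<tau>l: "\<tau> l \<in> {1..3}"
    using l permutes_in_image[OF perms(1)] by blast
  fix j :: nat assume j: "j \<in> {1..4}"
  then have "inv' \<sigma> j \<in> {1..4}"
    using permutes_in_image[OF permutes_inv[OF perms(2)]] by blast
  then show "row_sum (permute_sums \<tau> \<sigma> (cut_vector 4 {1, Suc l})) j
      = row_sum (cut_vector 4 {1, Suc (\<tau> l)}) j"
    by (simp only: sums_permute_sums(2)[OF cut_coord j] cut_pair_sums(2)[OF l] cut_pair_sums(2)[OF \<tau>l j])
qed

end

lemma permute_sums_comp: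
  assumes "\<tau> permutes {1..3}" "\<sigma> permutes {1..4}" "\<tau>' permutes {1..3}" "\<sigma>' permutes {1..4}"
    and x: "x \<in> coord_space (pairs 4)"
  shows "permute_sums (\<tau> \<circ> \<tau>') (\<sigma> \<circ> \<sigma>') x = permute_sums \<tau> \<sigma> (permute_sums \<tau>' \<sigma>' x)"
proof (intro sums_eqI permute_sums_coord x)
  note comps = permutes_compose[OF assms(3,1)] permutes_compose[OF assms(4,2)]
  note px = permute_sums_coord[OF x, of \<tau>' \<sigma>']
  fix k :: nat assume k: "k \<in> {1..3}"
  then have "inv' \<tau> k \<in> {1..3}"
    using permutes_in_image[OF permutes_inv[OF assms(1)]] by blast
  then show "matching_sum (permute_sums (\<tau> \<circ> \<tau>') (\<sigma> \<circ> \<sigma>') x) k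
      = matching_sum (permute_sums \<tau> \<sigma> (permute_sums \<tau>' \<sigma>' x)) k"
    by (simp only: sums_permute_sums(1)[OF comps x k] sums_permute_sums(1)[OF assms(1,2) px k]
        sums_permute_sums(1)[OF assms(3,4) x] o_inv_distrib permutes_bij[OF assms(1)] permutes_bij[OF assms(3)] comp_apply)
next
  note comps = permutes_compose[OF assms(3,1)] permutes_compose[OF assms(4,2)]
  note px = permute_sums_coord[OF x, of \<tau>' \<sigma>']
  fix i :: nat assume i: "i \<in> {1..4}"
  then have "inv' \<sigma> i \<in> {1..4}"
    using permutes_in_image[OF permutes_inv[OF assms(2)]] by blast
  then show "row_sum (permute_sums (\<tau> \<circ> \<tau>') (\<sigma> \<circ> \<sigma>') x) i
      = row_sum (permute_sums \<tau> \<sigma> (permute_sums \<tau>' \<sigma>' x)) i"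
    by (simp only: sums_permute_sums(2)[OF comps x i] sums_permute_sums(2)[OF assms(1,2) px i]
        sums_permute_sums(2)[OF assms(3,4) x] o_inv_distrib permutes_bij[OF assms(2)] permutes_bij[OF assms(4)] comp_apply)
qed

lemma permute_sums_id:
  assumes x: "x \<in> coord_space (pairs 4)"
  shows "permute_sums id id x = x"
  using x by (simp add: permute_sums_def of_sums_sums)

lemma permute_sums_symmetry:
  assumes perms: "\<tau> permutes {1..3}" "\<sigma> permutes {1..4}"
  shows "permute_sums \<tau> \<sigma> \<in> carrier (symmetry_group (pairs 4) (hypermetric_cone 4))"
proof (rule symmetry_groupI[OF permute_sums_linear[OF perms]])
  fix x :: "nat \<times> nat \<Rightarrow> real" assume x: "x \<in> coord_space (pairs 4)"
  have "2 * dot (pairs 4) (permute_sums \<tau> \<sigma> x) (permute_sums \<tau> \<sigma> x)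
      = (\<Sum>k=1..3. (matching_sum x (inv' \<tau> k))\<^sup>2) + (\<Sum>i=1..4. (row_sum x (inv' \<sigma> i))\<^sup>2)
        - (\<Sum>k=1..3. matching_sum x (inv' \<tau> k))\<^sup>2"
    unfolding dot_4 by (simp only: sums_permute_sums[OF perms x] cong: sum.cong)
  also have "\<dots> = 2 * dot (pairs 4) x x"
    unfolding dot_4 sum_inv_permute[OF perms(1), of "\<lambda>k. (matching_sum x k)\<^sup>2"]
      sum_inv_permute[OF perms(1)] sum_inv_permute[OF perms(2), of "\<lambda>k. (row_sum x k)\<^sup>2"] ..
  finally show "dot (pairs 4) (permute_sums \<tau> \<sigma> x) (permute_sums \<tau> \<sigma> x) = dot (pairs 4) x x"
    by simp
next
  note invs = permutes_inv[OF perms(1)] permutes_inv[OF perms(2)]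
  have "permute_sums \<tau> \<sigma> (permute_sums (inv' \<tau>) (inv' \<sigma>) x) = x" if "x \<in> hypermetric_cone 4" for x
    using permute_sums_comp[OF perms invs hypermetric_cone_coord[OF that]]
      permute_sums_id[OF hypermetric_cone_coord[OF that]]
      permutes_inv_o(1)[OF perms(1)] permutes_inv_o(1)[OF perms(2)] by simp
  note inverse = this
  show "permute_sums \<tau> \<sigma> ` hypermetric_cone 4 = hypermetric_cone 4"
  proof (intro equalityI subsetI)
    show "x \<in> permute_sums \<tau> \<sigma> ` hypermetric_cone 4" if "x \<in> hypermetric_cone 4" for x
      by (rule image_eqI[where x = "permute_sums (inv' \<tau>) (inv' \<sigma>) x"])
        (simp_all only: inverse[OF that] permute_sums_hypermetric[OF invs that])
  qed (use permute_sums_hypermetric[OF perms] in blast)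
qed

text \<open>The image has all row sums \<open>2\<close> and squared norm \<open>4\<close>, data
  common to the three two-point cuts. Its matching sums lie between \<open>0\<close> and
  \<open>2\<close>, add up to \<open>4\<close>, and have squares adding up to \<open>8\<close>, so
  the nonnegative values \<open>q * (2 - q)\<close> sum to zero. Each matching sum is thus
  \<open>0\<close> or \<open>2\<close>, and exactly one is \<open>0\<close>.\<close>

lemma symmetry_cut_pair_4:
  assumes g: "g \<in> carrier (symmetry_group (pairs 4) (hypermetric_cone 4))" and l: "l \<in> {1..3}"
  shows "\<exists>k\<in>{1..3}. g (cut_vector 4 {1, Suc l}) = cut_vector 4 {1, Suc k}"
proof -
  have n3: "(4 :: nat) \<ge> 3" by simp
  let ?x = "g (cut_vector 4 {1, Suc l})"
  have x: "?x \<in> hypermetric_cone 4" and xc: "?x \<in> coord_space (pairs 4)"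
    using symmetry_cut_hypermetric[OF n3 g] symmetry_coord[OF n3 g cut_coord] by auto
  interpret finite_semimetric "{1..4}" "entry ?x"
    by (rule hypermetric_cone_semimetric[OF x n3])
  obtain \<sigma> where \<sigma>: "\<sigma> permutes {1..4}"
    and single: "\<And>i. i \<in> {1..4} \<Longrightarrow> g (cut_vector 4 {i}) = cut_vector 4 {\<sigma> i}"
    using symmetry_permutes_cuts[OF n3 g] by blast
  have row: "row_sum ?x i = 2" if i: "i \<in> {1..4}" for i
  proof -
    have j: "inv' \<sigma> i \<in> {1..4}"
      using i permutes_in_image[OF permutes_inv[OF \<sigma>]] by blast
    have "row_sum ?x i = dot (pairs 4) ?x (cut_vector 4 {i})"
      by (simp only: row_sum_def dot_cut_singleton[OF i])
    also have "\<dots> = dot (pairs 4) ?x (g (cut_vector 4 {inv' \<sigma> i}))"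
      by (simp only: single[OF j] permutes_inverses[OF \<sigma>])
    also have "\<dots> = row_sum (cut_vector 4 {1, Suc l}) (inv' \<sigma> i)"
      by (simp only: symmetry_dot[OF n3 g] cut_coord dot_cut_singleton[OF j] row_sum_def)
    also have "\<dots> = 2"
      by (rule cut_pair_sums(2)[OF l j])
    finally show ?thesis .
  qed
  have rows: "(\<Sum>i=1..4. row_sum ?x i) = 8" "(\<Sum>i=1..4. (row_sum ?x i)\<^sup>2) = 16"
    using row[of 1] row[of 2] row[of 3] row[of 4] unfolding sum_1_4 by (simp_all add: power2_eq_square)
  have total: "matching_sum ?x 1 + matching_sum ?x 2 + matching_sum ?x 3 = 4"
    using rows(1) sum_row_sum[of ?x] unfolding sum_1_3 by simp
  have "dot (pairs 4) ?x ?x = dot (pairs 4) (cut_vector 4 {1, Suc l}) (cut_vector 4 {1, Suc l})"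
    by (simp only: symmetry_dot[OF n3 g] cut_coord)
  moreover have "2 * dot (pairs 4) (cut_vector 4 {1, Suc l}) (cut_vector 4 {1, Suc l}) = 8"
    unfolding dot_4 sum_1_4 sum_1_3 using cut_pair_sums[OF l] l
    by (auto simp: interval_1_3 interval_1_4 simp del: One_nat_def)
  ultimately have squares: "(matching_sum ?x 1)\<^sup>2 + (matching_sum ?x 2)\<^sup>2 + (matching_sum ?x 3)\<^sup>2 = 8"
    using dot_4[of ?x] rows(2) total unfolding sum_1_3 by simp
  have le: "matching_sum ?x k \<le> 2" if "k \<in> {1..3}" for k
    using x row[of 1] that unfolding hypermetric_cone_4_iff[OF xc] by force
  have ge: "matching_sum ?x k \<ge> 0" if "k \<in> {1..3}" for k
    using that nonneg[of 1 2] nonneg[of 3 4] nonneg[of 1 3] nonneg[of 2 4] nonneg[of 1 4] nonneg[of 2 3]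
    by (simp add: matching_sum_def entry_def)
  define h where "h k = matching_sum ?x k * (2 - matching_sum ?x k)" for k
  have h_ge: "h k \<ge> 0" if "k \<in> {1..3}" for k
    using le[OF that] ge[OF that] by (simp add: h_def)
  have h_sum: "(\<Sum>k=1..3. h k) = 0"
    using total squares unfolding sum_1_3 h_def by (simp add: power2_eq_square algebra_simps)
  have zero_two: "matching_sum ?x k = 0 \<or> matching_sum ?x k = 2" if "k \<in> {1..3}" for k
    using sum_nonneg_0[OF finite_atLeastAtMost h_ge h_sum that] by (auto simp: h_def)
  obtain k where k: "k \<in> {1..3}" "\<And>j. j \<in> {1..3} \<Longrightarrow> matching_sum ?x j = (if j = k then 0 else 2)"
  proof -
    have "\<exists>k\<in>{1..3}. \<forall>j\<in>{1..3}. matching_sum ?x j = (if j = k then 0 else 2)"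
      using zero_two[of 1] zero_two[of 2] zero_two[of 3] total
      unfolding interval_1_3 by (auto simp del: One_nat_def)
    then show thesis
      using that by blast
  qed
  have "?x = cut_vector 4 {1, Suc k}"
    by (rule sums_eqI[OF xc cut_coord]) (simp_all only: k(2) cut_pair_sums[OF k(1)] row)
  then show ?thesis
    using k(1) by blast
qed

lemma permutes_eqI:
  assumes "\<sigma> permutes S" "\<tau> permutes S" "\<And>i. i \<in> S \<Longrightarrow> \<sigma> i = \<tau> i"
  shows "\<sigma> = \<tau>"
proof
  show "\<sigma> i = \<tau> i" for i
    using assms by (cases "i \<in> S") (simp_all add: permutes_not_in)
qed

theorem symmetry_group_hypermetric_cone_4:
  "symmetry_group (pairs 4) (hypermetric_cone 4) \<cong> sym_group 3 \<times>\<times> sym_group 4"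
proof -
  let ?G = "symmetry_group (pairs 4) (hypermetric_cone 4)" and ?H = "sym_group 3 \<times>\<times> sym_group 4"
  let ?\<phi> = "\<lambda>(\<tau>, \<sigma>). permute_sums \<tau> \<sigma>"
  have n3: "(4 :: nat) \<ge> 3" by simp
  have "?\<phi> \<in> iso ?H ?G"
  proof (rule isoI)
    show "?\<phi> \<in> hom ?H ?G"
    proof (rule homI)
      fix p q assume "p \<in> carrier ?H" "q \<in> carrier ?H"
      moreover obtain \<tau> \<sigma> \<tau>' \<sigma>' where pq: "p = (\<tau>, \<sigma>)" "q = (\<tau>', \<sigma>')"
        by (cases p, cases q)
      ultimately have "\<tau> permutes {1..3}" "\<sigma> permutes {1..4}" "\<tau>' permutes {1..3}" "\<sigma>' permutes {1..4}"
        by (simp_all add: sym_group_carrier)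
      note comp = permute_sums_comp[OF this]
      show "?\<phi> (p \<otimes>\<^bsub>?H\<^esub> q) = ?\<phi> p \<otimes>\<^bsub>?G\<^esub> ?\<phi> q"
      proof
        fix x
        show "?\<phi> (p \<otimes>\<^bsub>?H\<^esub> q) x = (?\<phi> p \<otimes>\<^bsub>?G\<^esub> ?\<phi> q) x"
          using comp[of x] by (cases "x \<in> coord_space (pairs 4)")
            (simp_all add: pq sym_group_mult mult_symmetry_group compose_def, simp add: permute_sums_def)
      qed
    qed (auto simp: sym_group_carrier permute_sums_symmetry)
    show "bij_betw ?\<phi> (carrier ?H) (carrier ?G)"
    proof (intro bij_betw_imageI inj_onI equalityI subsetI)
      fix p q assume "p \<in> carrier ?H" "q \<in> carrier ?H" and eq: "?\<phi> p = ?\<phi> q"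
      moreover obtain \<tau> \<sigma> \<tau>' \<sigma>' where pq: "p = (\<tau>, \<sigma>)" "q = (\<tau>', \<sigma>')"
        by (cases p, cases q)
      ultimately have perms: "\<tau> permutes {1..3}" "\<sigma> permutes {1..4}" "\<tau>' permutes {1..3}" "\<sigma>' permutes {1..4}"
        and eq: "permute_sums \<tau> \<sigma> = permute_sums \<tau>' \<sigma>'"
        by (simp_all add: sym_group_carrier)
      \<comment> \<open>The two-point cuts recover \<open>\<tau>\<close>, and below the one-point
        cuts recover \<open>\<sigma>\<close>.\<close>
      have "\<tau> = \<tau>'"
      proof (rule permutes_eqI[OF perms(1,3)])
        fix k :: nat assume k: "k \<in> {1..3}"
        then show "\<tau> k = \<tau>' k"
          using permute_sums_cut_pair[OF perms(1,2) k] permute_sums_cut_pair[OF perms(3,4) k] eq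
            permutes_in_image[OF perms(1), of k] permutes_in_image[OF perms(3), of k]
          by (intro cut_pair_inject) simp_all
      qed
      moreover have "\<sigma> = \<sigma>'"
      proof (rule permutes_eqI[OF perms(2,4)])
        fix i :: nat assume i: "i \<in> {1..4}"
        then show "\<sigma> i = \<sigma>' i"
          using permute_sums_cut_singleton[OF perms(1,2) i] permute_sums_cut_singleton[OF perms(3,4) i] eq
            permutes_in_image[OF perms(2), of i] permutes_in_image[OF perms(4), of i]
          by (intro cut_singleton_inject[OF n3]) simp_all
      qed
      ultimately show "p = q"
        by (simp add: pq)
    next
      fix g assume g: "g \<in> carrier ?G"
      obtain \<sigma> where \<sigma>: "\<sigma> permutes {1..4}"
        and single: "\<And>i. i \<in> {1..4} \<Longrightarrow> g (cut_vector 4 {i}) = cut_vector 4 {\<sigma> i}"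
        using symmetry_permutes_cuts[OF n3 g] by blast
      \<comment> \<open>\<open>\<tau>\<close> is read off from the two-point cuts without reference
        to \<open>\<sigma>\<close>; the two permutations are the factors of the direct
        product.\<close>
      obtain \<tau> where \<tau>: "\<tau> permutes {1..3}"
        and pair: "\<And>k. k \<in> {1..3} \<Longrightarrow> g (cut_vector 4 {1, Suc k}) = cut_vector 4 {1, Suc (\<tau> k)}"
      proof -
        have "inj_on g ((\<lambda>k. cut_vector 4 {1, Suc k}) ` {1..3})"
          by (rule inj_on_subset[OF symmetry_inj[OF n3 g]]) auto
        moreover have "inj_on (\<lambda>k. cut_vector 4 {1, Suc k}) {1..3}"
          by (rule inj_onI) (rule cut_pair_inject)
        ultimately show thesis
          using image_permutes[of "{1..3}" "\<lambda>k. cut_vector 4 {1, Suc k}" g]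
            symmetry_cut_pair_4[OF g] that by blast
      qed
      have "g = permute_sums \<tau> \<sigma>"
      proof (rule linear_eqI_cuts[OF symmetry_groupD(1)[OF g] permute_sums_linear[OF \<tau> \<sigma>]])
        fix i :: nat assume i: "i \<in> {1..4}"
        show "g (cut_vector 4 {i}) = permute_sums \<tau> \<sigma> (cut_vector 4 {i})"
          by (simp only: single[OF i] permute_sums_cut_singleton[OF \<tau> \<sigma> i])
      next
        fix i j :: nat assume "i \<in> {1..4}" "j \<in> {1..4}" "i < j"
        then obtain k where k: "k \<in> {1..3}" "cut_vector 4 {i, j} = cut_vector 4 {1, Suc k}"
          by (rule cut_pair_cases)
        show "g (cut_vector 4 {i, j}) = permute_sums \<tau> \<sigma> (cut_vector 4 {i, j})"
          by (simp only: k(2) pair[OF k(1)] permute_sums_cut_pair[OF \<tau> \<sigma> k(1)])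
      qed
      then show "g \<in> ?\<phi> ` carrier ?H"
        using \<tau> \<sigma> by (force simp: sym_group_carrier)
    qed (auto simp: sym_group_carrier permute_sums_symmetry)
  qed
  then show ?thesis
    by (rule group.iso_sym[OF DirProd_group[OF sym_group_is_group sym_group_is_group] is_isoI])
qed

theorem corollary1:
  shows "(\<forall>n\<ge>5. symmetry_group (pairs n) (hypermetric_cone n) \<cong> sym_group n) \<and>
         symmetry_group (pairs 4) (hypermetric_cone 4) \<cong> sym_group 3 \<times>\<times> sym_group 4"
  using symmetry_group_hypermetric_cone symmetry_group_hypermetric_cone_4 by blast

end
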